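(* Let $k\ge 1$ be an integer. Let $U\subset\mathbb{P}^1(\mathbb{Z}_p)=\mathbb{P}^1(\mathbb{Q}_p)$ be an open subset with $(0:1)\notin U$, and let $V\subset \mathrm{GL}_2(\mathbb{Z}_p)$ be the inverse image of $U$ under $\left(\begin{smallmatrix}a&b\\c&d\end{smallmatrix}\right)\mapsto(c:d)$. Let $I_{k-1}:\mathcal{O}_\infty^{\mathrm{la},(1-k,0)}\to\mathcal{O}_\infty^{\mathrm{la},(1,-k)}(k)$ be the intertwining operator. Then for every $f:V\to\mathcal{O}(\mathcal{D}_\infty)$ in $\mathcal{O}_\infty^{\mathrm{la},(1-k,0)}(U)$, $$I_{k-1}(f)=\frac{(ad-bc)^{k}}{e^{k}c^{2k}}\,(a\partial_b+c\partial_d)^{k}\Big(q\frac{d}{dq}\Big)^{k}f .$$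
   Context: Cusp setting. Let $p$ be a prime, $C=\widehat{\overline{\mathbb{Q}}}_p$, $N$ an integer coprime to $p$, and $e$ a positive divisor of $N$ (a cusp of the modular curve corresponds to a level structure on the Tate curve $T(q^e)$). Fix a compatible system $(\zeta_{p^n})_n$ of primitive $p^n$-th roots of unity. $\mathcal{D}_\infty$ is the perfectoid open unit disc over $C$ (the locus $|q|<1$ in $\mathrm{Spa}(C\langle q^{1/p^\infty}\rangle,\mathcal{O}_C\langle q^{1/p^\infty}\rangle)$). $\mathcal{O}(\mathcal{D}_\infty)$ is the ring of series $\sum_{n\in\mathbb{Z}[1/p]_{\ge0}}a_nq^n$, $a_n\in C$, with $|a_n|r^n\to0$ for all $0\le r<1$ and such that for each $\delta>0$ and each bounded interval $I$ only finitely many $n\in I$ have $|a_n|>\delta$, with its Fréchet topology. $\mathcal{O}(\mathcal{D}_m)\subset\mathcal{O}(\mathcal{D}_\infty)$ is the subring of series supported on $n\in\frac1{p^m}\mathbb{Z}_{\ge0}$. $\mathbb{Z}_p$ acts on $\mathcal{O}(\mathcal{D}_\infty)$ by $h\cdot q^{1/p^n}=\zeta_{p^n}^{h/e}q^{1/p^n}$. Sheaf $\mathcal{O}_\infty$ on $\mathbb{P}^1(\mathbb{Z}_p)$: for $U$ open with inverse image $V\subset\mathrm{GL}_2(\mathbb{Z}_p)$ under $\left(\begin{smallmatrix}a&b\\c&d\end{smallmatrix}\right)\mapsto(c:d)$, $\mathcal{O}_\infty(U)$ is the set of continuous $f:V\to\mathcal{O}(\mathcal{D}_\infty)$ with $f\left(\begin{smallmatrix}a&b\\c&d\end{smallmatrix}\right)=h\cdot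 f\left(\begin{smallmatrix}a+hc&b+hd\\c&d\end{smallmatrix}\right)$ for all $h\in\mathbb{Z}_p$. $\mathrm{GL}_2(\mathbb{Z}_p)$ acts by $(\gamma f)(g)=f(g\gamma)$, and $\mathcal{O}_\infty^{\mathrm{la}}\subset\mathcal{O}_\infty$ is the subsheaf of locally analytic sections for this action (locally on $U$, locally analytic vectors for some $\Gamma(p^n)$). $\partial_a,\partial_b,\partial_c,\partial_d$ denote partial derivatives in the matrix entries. Locally analytic sections locally take values in some $\mathcal{O}(\mathcal{D}_m)$, so $q\frac{d}{dq}$ (sending $q^n$ to $nq^n$) acts on them. Horizontal action. $\mathfrak{gl}_2$ acts on $\mathcal{O}_\infty^{\mathrm{la}}$ by differentiating right translation; functions on $\mathbb{P}^1(\mathbb{Z}_p)$ act by multiplication after composing with $g\mapsto(c:d)$. For $z=(c:d)$ let $\mathfrak{b}_z=\{X\in\mathfrak{gl}_2:(c,d)X\in\langle(c,d)\rangle\}$ and let $\mathfrak{n}_z$ be its nilpotent radical; let $\mathfrak{n}^0\subset\mathfrak{b}^0\subset\mathfrak{gl}_2\otimes\mathcal{O}_{\mathbb{P}^1(\mathbb{Z}_p)}$ be the sections lying pointwise in $\mathfrak{n}_z$, $\mathfrak{b}_z$. $\mathfrak{n}^0$ acts trivially on $\mathcal{O}_\infty^{\mathrm{la}}$, so $\mathfrak{b}^0/\mathfrak{n}^0\cong\mathfrak{h}\otimes\mathcal{O}_{\mathbb{P}^1(\mathbb{Z}_p)}$ acts, where $\mathfrak{h}$ is the Lie algebra of diagonal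 matrices and an element of $\mathfrak{b}^0$ corresponds to $\mathrm{diag}(\alpha,\delta)$ with $\delta$ its eigenvalue on the line $\langle(c,d)\rangle$ and $\alpha$ its eigenvalue on the quotient. The resulting action of $\mathfrak{h}$ is $\theta_{\mathfrak{h}}$ (explicitly, where $c\ne0$ and with $x=d/c$, $\theta_{\mathfrak{h}}(\mathrm{diag}(\alpha,\delta))$ is the action of $\left(\begin{smallmatrix}\delta&(\delta-\alpha)x\\0&\alpha\end{smallmatrix}\right)$). $\mathcal{O}_\infty^{\mathrm{la},(n_1,n_2)}$ is the subsheaf where $\theta_{\mathfrak{h}}(\mathrm{diag}(\alpha,\delta))$ acts by $n_1\alpha+n_2\delta$. $(k)$ is the Tate twist, with basis given by $(\zeta_{p^n})_n$ and suppressed in formulas. Intertwining operator. $\mathcal{O}_\infty^{\mathrm{sm}}$ is the sheaf of smooth vectors in $\mathcal{O}_\infty$, $\Omega^1_\infty(\mathcal{C})^{\mathrm{sm}}$ the sheaf of differentials with log pole at $q=0$ (free over $\mathcal{O}_\infty^{\mathrm{sm}}$ on $\frac{dq}{q}$), $\mathcal{O}_{\mathbb{P}^1},\Omega^1_{\mathbb{P}^1}$ locally analytic functions and differentials on $\mathbb{P}^1(\mathbb{Z}_p)$, $x=d/c$. On $\mathcal{O}_\infty^{\mathrm{la},(1-k,0)}$ put $d^k(f)=\left(\frac{q}{e}\frac{d}{dq}\right)^kf\otimes\left(\frac{dq}{q}\right)^{\otimes k}$ and, where $c\neq0$, $\overline d^k(f)=(u^+)^kf\otimes(dx)^{\otimes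 k}$, with $u^+=\left(\begin{smallmatrix}0&1\\0&0\end{smallmatrix}\right)$ acting as $a\partial_b+c\partial_d$. $I_{k-1}$ is the composite $d^k\circ\overline d^k=\overline d^k\circ d^k$ followed by the isomorphism $(\Omega^1_\infty(\mathcal{C})^{\mathrm{sm}})^{\otimes k}\otimes_{\mathcal{O}_\infty^{\mathrm{sm}}}\mathcal{O}_\infty^{\mathrm{la},(1-k,0)}\otimes_{\mathcal{O}_{\mathbb{P}^1}}(\Omega^1_{\mathbb{P}^1})^{\otimes k}\cong\mathcal{O}_\infty^{\mathrm{la},(1,-k)}(k)$ which, where $c\neq 0$, sends $(\frac{dq}q)^{\otimes k}\otimes f\otimes(dx)^{\otimes k}$ to $\frac{(ad-bc)^k}{c^{2k}}f$. *)

theory Defs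
  imports "HOL-Analysis.Analysis" "HOL-Computational_Algebra.Computational_Algebra"
begin

section \<open>The field of coefficients\<close>

text \<open>The library's \<open>norm\<close> is only available on real vector spaces.\<close>

class ultrametric_field = field_char_0 + metric_space +
  fixes absval :: "'a \<Rightarrow> real"
  assumes dist_absval: "dist x y = absval (x - y)"
    and absval_mult: "absval (x * y) = absval x * absval y"
    and absval_add: "absval (x + y) \<le> max (absval x) (absval y)"

text \<open>When the absolute value of \<open>p\<close> is \<open>1 / p\<close> and the field is complete, the following closures are
  the \<open>p\<close>-adic numbers and the \<open>p\<close>-adic integers.\<close>

definition Qp :: "'c::ultrametric_field set" where
  "Qp = closure \<rat>"

definition Zp :: "'c::ultrametric_field set" where
  "Zp = closure \<int>"

definition Qp_bar :: "'c::ultrametric_field set" where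
  "Qp_bar = {x. \<exists>P :: 'c poly. P \<noteq> 0 \<and> (\<forall>i. coeff P i \<in> Qp) \<and> poly P x = 0}"

text \<open>The type \<open>'c\<close> is a completion of an algebraic closure of the field of \<open>p\<close>-adic numbers,
  with its absolute value normalised by \<open>absval p = 1 / p\<close>. This determines \<open>'c\<close>
  up to isometric isomorphism.\<close>

definition is_completed_algebraic_closure :: "nat \<Rightarrow> 'c::ultrametric_field itself \<Rightarrow> bool" where
  "is_completed_algebraic_closure p _ \<longleftrightarrow>
     absval (of_nat p :: 'c) = 1 / real p \<and>
     complete (UNIV :: 'c set) \<and>
     (\<forall>P :: 'c poly. (\<forall>i. coeff P i \<in> Qp_bar) \<and> degree P > 0 \<longrightarrow> (\<exists>x\<in>Qp_bar. poly P x = 0)) \<and>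
     closure (Qp_bar :: 'c set) = UNIV"

definition compatible_roots :: "nat \<Rightarrow> (nat \<Rightarrow> 'c::ultrametric_field) \<Rightarrow> bool" where
  "compatible_roots p \<zeta> \<longleftrightarrow>
     (\<forall>n. \<zeta> n ^ (p ^ n) = 1 \<and> (\<forall>m. 0 < m \<and> m < p ^ n \<longrightarrow> \<zeta> n ^ m \<noteq> 1) \<and> \<zeta> (Suc n) ^ p = \<zeta> n)"

text \<open>The power of \<open>\<zeta> n\<close>, a \<open>p ^ n\<close>-th root of unity, with exponent \<open>x\<close> in \<open>Zp\<close>:
  the exponent is reduced modulo \<open>p ^ n\<close>.\<close>

definition root_power :: "nat \<Rightarrow> (nat \<Rightarrow> 'c::ultrametric_field) \<Rightarrow> nat \<Rightarrow> 'c \<Rightarrow> 'c" where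
  "root_power p \<zeta> n x =
     \<zeta> n ^ (THE m. m < p ^ n \<and> absval (x - of_nat m) \<le> 1 / real p ^ n)"


section \<open>Functions on the perfectoid open unit disc\<close>

text \<open>A series \<open>\<Sum>\<^sub>s a s q^s\<close> is represented by its coefficients \<open>a :: rat \<Rightarrow> 'c\<close>,
  supported on the nonnegative elements of \<open>\<int>[1/p]\<close>.\<close>

definition exponents :: "nat \<Rightarrow> rat set" where
  "exponents p = {s. 0 \<le> s \<and> (\<exists>n. s * of_nat p ^ n \<in> \<int>)}"

definition OD :: "nat \<Rightarrow> (rat \<Rightarrow> 'c::ultrametric_field) set" where
  "OD p = {a. (\<forall>s. s \<notin> exponents p \<longrightarrow> a s = 0) \<and>
     (\<forall>r. 0 \<le> r \<and> r < 1 \<longrightarrow> ((\<lambda>s. absval (a s) * r powr real_of_rat s) \<longlongrightarrow> 0) at_top) \<and>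
     (\<forall>\<delta>>0. \<forall>l u. finite {s. l \<le> s \<and> s \<le> u \<and> absval (a s) > \<delta>})}"

definition gauss_norm :: "real \<Rightarrow> (rat \<Rightarrow> 'c::ultrametric_field) \<Rightarrow> real" where
  "gauss_norm r a = (SUP s. absval (a s) * r powr real_of_rat s)"

text \<open>The Frechet topology, given by the norms \<open>gauss_norm r\<close> for \<open>0 < r < 1\<close>.\<close>

definition OD_topology :: "nat \<Rightarrow> (rat \<Rightarrow> 'c::ultrametric_field) topology" where
  "OD_topology p = topology_generated_by
     {{b \<in> OD p. gauss_norm r (\<lambda>s. b s - a s) < \<epsilon>} | a r \<epsilon>. a \<in> OD p \<and> 0 < r \<and> r < 1 \<and> 0 < \<epsilon>}"

text \<open>The action of \<open>h\<close> in \<open>Zp\<close>: writing \<open>s = j / p ^ n\<close>, the monomial \<open>q^s\<close> is multiplied by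
  the \<open>j\<close>-th power of \<open>\<zeta> n\<close> to the power \<open>h / e\<close>. This does not depend on the choice
  of \<open>n\<close>; we take it minimal.\<close>

definition Zp_act ::
  "nat \<Rightarrow> nat \<Rightarrow> (nat \<Rightarrow> 'c::ultrametric_field) \<Rightarrow> 'c \<Rightarrow> (rat \<Rightarrow> 'c) \<Rightarrow> (rat \<Rightarrow> 'c)" where
  "Zp_act p e \<zeta> h a = (\<lambda>s.
     let n = (LEAST n. s * of_nat p ^ n \<in> \<int>); j = nat \<lfloor>s * of_nat p ^ n\<rfloor>
     in root_power p \<zeta> n (h / of_nat e) ^ j * a s)"


section \<open>Matrices and the projective line\<close>

definition mat2 :: "'c \<Rightarrow> 'c \<Rightarrow> 'c \<Rightarrow> 'c \<Rightarrow> 'c::zero^2^2" where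
  "mat2 a b c d = vector [vector [a, b], vector [c, d]]"

definition scale_mat :: "'c::times \<Rightarrow> 'c^2^2 \<Rightarrow> 'c^2^2" where
  "scale_mat t X = (\<chi> i j. t * X$i$j)"

definition M2 :: "'c set \<Rightarrow> ('c^2^2) set" where
  "M2 R = {X. \<forall>i j. X$i$j \<in> R}"

definition GL2_Zp :: "('c::ultrametric_field^2^2) set" where
  "GL2_Zp = {g \<in> M2 Zp. \<exists>g'\<in>M2 Zp. g ** g' = mat 1 \<and> g' ** g = mat 1}"

text \<open>The point \<open>(c : d)\<close> is the line over \<open>Qp\<close> spanned by the vector \<open>(c, d)\<close>;
  \<open>P1\<close> carries the quotient topology.\<close>

definition nonzero_vectors :: "('c::ultrametric_field^2) set" where
  "nonzero_vectors = {v. (\<forall>i. v$i \<in> Qp) \<and> v \<noteq> 0}"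

definition line :: "'c::ultrametric_field^2 \<Rightarrow> ('c^2) set" where
  "line v = {t *s v | t. t \<in> Qp}"

definition P1 :: "('c::ultrametric_field^2) set set" where
  "P1 = line ` nonzero_vectors"

definition open_P1 :: "('c::ultrametric_field^2) set set \<Rightarrow> bool" where
  "open_P1 U \<longleftrightarrow> U \<subseteq> P1 \<and> openin (top_of_set nonzero_vectors) {v \<in> nonzero_vectors. line v \<in> U}"

definition GL2_preimage :: "('c::ultrametric_field^2) set set \<Rightarrow> ('c^2^2) set" where
  "GL2_preimage U = {g \<in> GL2_Zp. line (row 2 g) \<in> U}"


section \<open>The sheaf and its locally analytic sections\<close>

text \<open>Sections over \<open>U\<close> are functions on \<open>GL2_preimage U\<close>; their values elsewhere are irrelevant.\<close>

type_synonym 'c sect = "'c^2^2 \<Rightarrow> rat \<Rightarrow> 'c"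

definition O_inf :: "nat \<Rightarrow> nat \<Rightarrow> (nat \<Rightarrow> 'c::ultrametric_field) \<Rightarrow>
    ('c^2) set set \<Rightarrow> 'c sect set" where
  "O_inf p e \<zeta> U = {f.
     continuous_map (top_of_set (GL2_preimage U)) (OD_topology p) f \<and>
     (\<forall>g\<in>GL2_preimage U. \<forall>h\<in>Zp. f g = Zp_act p e \<zeta> h (f (mat2 1 h 0 1 ** g)))}"

definition monomial :: "'c::comm_ring_1^2^2 \<Rightarrow> nat^2^2 \<Rightarrow> 'c" where
  "monomial X \<nu> = (\<Prod>i\<in>UNIV. \<Prod>j\<in>UNIV. (X$i$j) ^ (\<nu>$i$j))"

text \<open>The set \<open>U\<close> is stable under \<open>\<Gamma>(p ^ n) = 1 + p ^ n M2(Zp)\<close>, and the orbit map of \<open>f\<close> is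
  \<open>1 + p ^ n X \<mapsto> \<Sum>\<^sub>\<nu> w \<nu> X^\<nu>\<close>, where the sections \<open>w \<nu>\<close> over \<open>U\<close> tend to \<open>0\<close>. A set stable
  under \<open>\<Gamma>(p ^ n)\<close> is a finite union of open orbits, hence compact, so that the space of
  sections over \<open>U\<close> is topologised by the suprema of the Gauss norms over \<open>GL2_preimage U\<close>.\<close>

definition analytic_vector :: "nat \<Rightarrow> nat \<Rightarrow> (nat \<Rightarrow> 'c::ultrametric_field) \<Rightarrow> nat \<Rightarrow>
    ('c^2) set set \<Rightarrow> 'c sect \<Rightarrow> bool" where
  "analytic_vector p e \<zeta> n U f \<longleftrightarrow>
     f \<in> O_inf p e \<zeta> U \<and>
     (\<forall>g\<in>GL2_preimage U. \<forall>X\<in>M2 Zp. g ** (mat 1 + scale_mat (of_nat p ^ n) X) \<in> GL2_preimage U) \<and>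
     (\<exists>w :: nat^2^2 \<Rightarrow> 'c sect.
        (\<forall>\<nu>. w \<nu> \<in> O_inf p e \<zeta> U) \<and>
        (\<forall>r \<epsilon>. 0 < r \<and> r < 1 \<and> 0 < \<epsilon> \<longrightarrow>
           finite {\<nu>. \<exists>g\<in>GL2_preimage U. gauss_norm r (w \<nu> g) \<ge> \<epsilon>}) \<and>
        (\<forall>X\<in>M2 Zp. \<forall>r \<epsilon>. 0 < r \<and> r < 1 \<and> 0 < \<epsilon> \<longrightarrow>
           (\<forall>\<^sub>F F in finite_subsets_at_top UNIV. \<forall>g\<in>GL2_preimage U.
              gauss_norm r (\<lambda>s. f (g ** (mat 1 + scale_mat (of_nat p ^ n) X)) s
                                - (\<Sum>\<nu>\<in>F. monomial X \<nu> * w \<nu> g s)) < \<epsilon>)))"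

definition O_la :: "nat \<Rightarrow> nat \<Rightarrow> (nat \<Rightarrow> 'c::ultrametric_field) \<Rightarrow>
    ('c^2) set set \<Rightarrow> 'c sect set" where
  "O_la p e \<zeta> U = {f \<in> O_inf p e \<zeta> U.
     \<forall>z\<in>U. \<exists>U' n. open_P1 U' \<and> z \<in> U' \<and> U' \<subseteq> U \<and> n \<ge> 1 \<and> analytic_vector p e \<zeta> n U' f}"


section \<open>Differential operators\<close>

text \<open>The derivative at \<open>0\<close> of a function \<open>\<psi>\<close> from a neighbourhood of \<open>0\<close> in \<open>Zp\<close> to \<open>OD p\<close>.\<close>

definition deriv_0 :: "nat \<Rightarrow> ('c::ultrametric_field \<Rightarrow> rat \<Rightarrow> 'c) \<Rightarrow> rat \<Rightarrow> 'c" where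
  "deriv_0 p \<psi> = (THE l. limitin (OD_topology p) (\<lambda>t s. (\<psi> t s - \<psi> 0 s) / t) l (at 0 within Zp))"

definition partial_deriv :: "nat \<Rightarrow> 2 \<Rightarrow> 2 \<Rightarrow> 'c::ultrametric_field sect \<Rightarrow> 'c sect" where
  "partial_deriv p i j f g =
     deriv_0 p (\<lambda>t. f (g + (\<chi> i' j'. if i' = i \<and> j' = j then t else 0)))"

definition mat_exp :: "'c::ultrametric_field^2^2 \<Rightarrow> 'c^2^2" where
  "mat_exp X = (\<Sum>n. scale_mat (1 / fact n) ((((**) X) ^^ n) (mat 1)))"

definition gl2_act :: "nat \<Rightarrow> 'c::ultrametric_field^2^2 \<Rightarrow> 'c sect \<Rightarrow> 'c sect" where
  "gl2_act p X f g = deriv_0 p (\<lambda>t. f (g ** mat_exp (scale_mat t X)))"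

text \<open>The matrix \<open>X\<close> lies in the Borel subalgebra at \<open>(c : d)\<close>, where \<open>v = (c, d)\<close>, with
  eigenvalue \<open>\<delta>\<close> on the line spanned by \<open>v\<close> and \<open>\<alpha>\<close> on the quotient by this line.\<close>

definition borel_eigenvalues ::
  "'c::ultrametric_field^2 \<Rightarrow> 'c^2^2 \<Rightarrow> 'c \<Rightarrow> 'c \<Rightarrow> bool" where
  "borel_eigenvalues v X \<alpha> \<delta> \<longleftrightarrow>
     v v* X = \<delta> *s v \<and> (\<forall>u. \<exists>t. u v* X - \<alpha> *s u = t *s v)"

text \<open>A function \<open>\<phi>\<close> on \<open>P1\<close> acts by multiplication with \<open>\<phi> (c : d)\<close>, so the value at \<open>g\<close> of the
  action of a section of \<open>\<bb>\<^sup>0\<close> is that of the action of the constant matrix which is the value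
  of the section at \<open>(c : d)\<close>. Hence the horizontal action can be tested on each fibre.\<close>

definition O_la_weight :: "nat \<Rightarrow> nat \<Rightarrow> (nat \<Rightarrow> 'c::ultrametric_field) \<Rightarrow> int \<Rightarrow> int \<Rightarrow>
    ('c^2) set set \<Rightarrow> 'c sect set" where
  "O_la_weight p e \<zeta> n\<^sub>1 n\<^sub>2 U = {f \<in> O_la p e \<zeta> U.
     \<forall>g\<in>GL2_preimage U. \<forall>X\<in>M2 Qp. \<forall>\<alpha>\<in>Qp. \<forall>\<delta>\<in>Qp. borel_eigenvalues (row 2 g) X \<alpha> \<delta> \<longrightarrow>
       gl2_act p X f g = (\<lambda>s. (of_int n\<^sub>1 * \<alpha> + of_int n\<^sub>2 * \<delta>) * f g s)}"

definition q_ddq :: "'c::field_char_0 sect \<Rightarrow> 'c sect" where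
  "q_ddq f g = (\<lambda>s. of_rat s * f g s)"

definition a_b_plus_c_d :: "nat \<Rightarrow> 'c::ultrametric_field sect \<Rightarrow> 'c sect" where
  "a_b_plus_c_d p f g =
     (\<lambda>s. g$1$1 * partial_deriv p 1 2 f g s + g$2$1 * partial_deriv p 2 2 f g s)"


section \<open>The intertwining operator\<close>

text \<open>Over the locus \<open>c \<noteq> 0\<close> the modules of differentials are free of rank one, on \<open>dq/q\<close> and on
  \<open>dx\<close> with \<open>x = d/c\<close>. So a section of the tensor product of \<open>i\<close> copies of the first, the
  locally analytic sections, and \<open>j\<close> copies of the second is uniquely of the form
  \<open>(dq/q)\<^sup>i \<otimes> f \<otimes> (dx)\<^sup>j\<close>, written \<open>Tensor i f j\<close>.\<close>

datatype 's tensor = Tensor nat 's nat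

text \<open>The operators \<open>d^k\<close> and its conjugate are extended to tensors linearly in the
  differentials \<open>dx\<close> and \<open>dq/q\<close> respectively.\<close>

fun d_op :: "nat \<Rightarrow> nat \<Rightarrow> 'c::ultrametric_field sect tensor \<Rightarrow> 'c sect tensor" where
  "d_op e k (Tensor i f j) = Tensor (i + k) (((\<lambda>f g s. q_ddq f g s / of_nat e) ^^ k) f) j"

fun dbar_op :: "nat \<Rightarrow> nat \<Rightarrow> 'c::ultrametric_field sect tensor \<Rightarrow> 'c sect tensor" where
  "dbar_op p k (Tensor i f j) = Tensor i ((gl2_act p (mat2 0 1 0 0) ^^ k) f) (j + k)"

text \<open>The Tate twist in the target is trivialised by \<open>\<zeta>\<close>.\<close>

fun contract :: "nat \<Rightarrow> 'c::ultrametric_field sect tensor \<Rightarrow> 'c sect" where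
  "contract k (Tensor i f j) =
     (if i = k \<and> j = k then (\<lambda>g s. det g ^ k / (g$2$1) ^ (2 * k) * f g s) else undefined)"

text \<open>The operator usually denoted \<open>I\<close> with index \<open>k - 1\<close>, on sections over sets
  not containing \<open>(0 : 1)\<close>.\<close>

definition intertwining :: "nat \<Rightarrow> nat \<Rightarrow> nat \<Rightarrow> 'c::ultrametric_field sect \<Rightarrow> 'c sect" where
  "intertwining p e k f = contract k (d_op e k (dbar_op p k (Tensor 0 f 0)))"

end

theory Submission
  imports Defs
begin

text \<open>
  After the scalars \<open>e\<close>, \<open>c\<close> and \<open>ad - bc\<close> are collected, the assertion is that \<open>q d/dq\<close> commutes with
  the derivative along right translation by the unipotent \<open>1 + t u\<^sup>+\<close>, and that this derivative is the
  field \<open>a \<partial>\<^sub>b + c \<partial>\<^sub>d\<close>, because \<open>g (1 + t u\<^sup>+)\<close> arises from \<open>g\<close> by adding \<open>t\<close> times the first column to the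
  second. The content lies in the existence of the iterated derivatives: each derivative is a limit in
  the Frechet topology, so one needs a class of functions on which these limits exist and obey the
  chain rule, and which is preserved by the derivatives and by \<open>q d/dq\<close>.

  Since no operator moves the first column, it suffices to look at the functions
  \<open>(x, y) \<mapsto> f (g (1 + p^n X))\<close> where \<open>X\<close> has zero first column and second column \<open>(x, y)\<close>. For a locally
  analytic section these are power series on \<open>\<int>\<^sub>p\<^sup>2\<close> with coefficients in the functions on the disc
  (\<open>expands\<close>, \<open>analytic_vector_expands\<close>). In these coordinates the action of \<open>u\<^sup>+\<close> and \<open>a \<partial>\<^sub>b + c \<partial>\<^sub>d\<close> are both
  \<open>p\<^sup>-\<^sup>n \<partial>\<^sub>x\<close> (\<open>expands_gl2_act\<close>, \<open>expands_a_b_plus_c_d\<close>): the columns of \<open>g\<^sup>-\<^sup>1\<close>, which express \<open>\<partial>\<^sub>b\<close> and \<open>\<partial>\<^sub>d\<close>, are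
  recombined with the weights \<open>a\<close> and \<open>c\<close> into \<open>g\<^sup>-\<^sup>1 (a, c) = (1, 0)\<close>. The operator \<open>q d/dq\<close> multiplies
  the coefficient of \<open>q^s\<close> by \<open>s\<close>, hence commutes with \<open>\<partial>\<^sub>x\<close>. So both sides of the assertion have
  the same power series, and the constant terms give the theorem.

  The limits exist because the second order Taylor remainder of a power series is bounded by the
  square of the increment times the supremum of the coefficients (\<open>series_first_order\<close>),
  uniformly in \<open>s\<close>. The operator \<open>q d/dq\<close> preserves the functions on the disc only if \<open>s\<close> has bounded
  denominator. This follows from the equivariance of \<open>f\<close> (\<open>analytic_vector_level\<close>): along
  \<open>h \<in> p^n \<int>\<^sub>p\<close>, left translation by the upper unipotent multiplies the coefficient of \<open>q^s\<close> by a locally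
  constant character of \<open>h\<close>, but the dependence on \<open>h\<close> is also analytic; by the identity theorem
  (\<open>graded_series_constant\<close>) the character is trivial on \<open>e p^n\<close>, whence \<open>s p^n\<close> is an integer.
\<close>

text \<open>In formulas with several matrix entries, the second meaning of \<open>$\<close> as coefficient of a formal
  power series would multiply the number of parses.\<close>

no_notation fps_nth (infixl \<open>$\<close> 75)

section \<open>Ultrametric absolute values\<close>

lemma absval_eq_dist: "absval x = dist x (0::'c::ultrametric_field)"
  by (simp add: dist_absval)

lemma absval_zero [simp]: "absval (0::'c::ultrametric_field) = 0"
  by (simp add: absval_eq_dist)

lemma absval_eq_0_iff [simp]: "absval x = 0 \<longleftrightarrow> x = (0::'c::ultrametric_field)"
  by (simp add: absval_eq_dist)

lemma absval_nonneg [simp]: "0 \<le> absval (x::'c::ultrametric_field)"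
  by (simp add: absval_eq_dist)

lemma absval_pos_iff [simp]: "0 < absval x \<longleftrightarrow> x \<noteq> (0::'c::ultrametric_field)"
  by (simp add: absval_eq_dist)

lemma absval_le_0_iff [simp]: "absval x \<le> 0 \<longleftrightarrow> x = (0::'c::ultrametric_field)"
proof
  assume "absval x \<le> 0"
  then have "absval x = 0" using absval_nonneg[of x] by linarith
  then show "x = 0" by simp
qed simp

lemma absval_one [simp]: "absval (1::'c::ultrametric_field) = 1"
  using absval_mult[of "1::'c" 1] by simp

lemma absval_minus [simp]: "absval (- x) = absval (x::'c::ultrametric_field)"
  using dist_commute[of 0 x] by (simp add: dist_absval)

lemma absval_diff: "absval (x - y) \<le> max (absval x) (absval (y::'c::ultrametric_field))"
  using absval_add[of x "- y"] by simp

lemma absval_minus_commute: "absval (x - y) = absval (y - (x::'c::ultrametric_field))"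
  using absval_minus[of "x - y"] by simp

lemma absval_add_le:
  "absval x \<le> B \<Longrightarrow> absval y \<le> B \<Longrightarrow> absval (x + y) \<le> (B::real)" for x y :: "'c::ultrametric_field"
  using absval_add[of x y] by simp

lemma absval_diff_le:
  "absval x \<le> B \<Longrightarrow> absval y \<le> B \<Longrightarrow> absval (x - y) \<le> (B::real)" for x y :: "'c::ultrametric_field"
  using absval_diff[of x y] by simp

lemma absval_power: "absval (x ^ n) = absval (x::'c::ultrametric_field) ^ n"
  by (induction n) (auto simp: absval_mult)

lemma absval_inverse: "absval (inverse x) = inverse (absval (x::'c::ultrametric_field))"
proof (cases "x = 0")
  case False
  then have "absval (inverse x) * absval x = 1"
    by (simp flip: absval_mult)
  then show ?thesis
    by (metis inverse_unique mult.commute)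
qed simp

lemma absval_divide: "absval (x / y) = absval x / absval (y::'c::ultrametric_field)"
  by (simp add: divide_inverse absval_mult absval_inverse)

lemma absval_of_nat_le_1: "absval (of_nat n :: 'c::ultrametric_field) \<le> 1"
  by (induction n) (auto intro: absval_add_le)

lemma absval_of_int_le_1: "absval (of_int z :: 'c::ultrametric_field) \<le> 1"
  by (cases z rule: int_cases2) (auto simp: absval_of_nat_le_1)

lemma absval_mult_le_1:
  "absval x \<le> 1 \<Longrightarrow> absval y \<le> 1 \<Longrightarrow> absval (x * y) \<le> 1" for x y :: "'c::ultrametric_field"
  by (simp add: absval_mult mult_le_one)

lemma absval_power_le_1: "absval x \<le> 1 \<Longrightarrow> absval (x ^ n) \<le> 1" for x :: "'c::ultrametric_field"
  by (simp add: absval_power power_le_one)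

lemma absval_sum_le:
  fixes f :: "'i \<Rightarrow> 'c::ultrametric_field"
  assumes "0 \<le> B" and "\<And>i. i \<in> F \<Longrightarrow> absval (f i) \<le> B"
  shows "absval (sum f F) \<le> B"
  using assms(2)
  by (induction F rule: infinite_finite_induct) (auto simp: assms(1) intro!: absval_add_le)

lemma tendsto_iff_absval:
  fixes l :: "'c::ultrametric_field"
  shows "(f \<longlongrightarrow> l) F \<longleftrightarrow> (\<forall>\<epsilon>>0. \<forall>\<^sub>F x in F. absval (f x - l) < \<epsilon>)"
  by (simp add: tendsto_iff dist_absval)

instance ultrametric_field \<subseteq> topological_ab_group_add
proof
  fix a b :: 'a
  show "LIM x nhds a \<times>\<^sub>F nhds b. fst x + snd x :> nhds (a + b)"
    unfolding tendsto_iff_absval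
  proof (intro allI impI)
    fix \<epsilon> :: real assume "\<epsilon> > 0"
    then have "\<forall>\<^sub>F x in nhds a. absval (x - a) < \<epsilon>" "\<forall>\<^sub>F y in nhds b. absval (y - b) < \<epsilon>"
      by (auto simp: eventually_nhds_metric dist_absval)
    then have "\<forall>\<^sub>F z in nhds a \<times>\<^sub>F nhds b. absval (fst z - a) < \<epsilon> \<and> absval (snd z - b) < \<epsilon>"
      unfolding eventually_prod_filter by auto
    then show "\<forall>\<^sub>F z in nhds a \<times>\<^sub>F nhds b. absval (fst z + snd z - (a + b)) < \<epsilon>"
    proof (rule eventually_mono)
      fix z assume "absval (fst z - a) < \<epsilon> \<and> absval (snd z - b) < \<epsilon>"
      then have "absval ((fst z - a) + (snd z - b)) < \<epsilon>"
        using absval_add[of "fst z - a" "snd z - b"] by linarith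
      then show "absval (fst z + snd z - (a + b)) < \<epsilon>"
        by (simp add: algebra_simps)
    qed
  qed
  show "(uminus \<longlongrightarrow> - a) (nhds a)"
    unfolding tendsto_iff_absval
    by (auto simp: eventually_nhds_metric dist_absval absval_minus_commute)
qed

lemma tendsto_cmult_ultrametric:
  fixes c l :: "'c::ultrametric_field"
  assumes "(f \<longlongrightarrow> l) F"
  shows "((\<lambda>x. c * f x) \<longlongrightarrow> c * l) F"
proof (cases "c = 0")
  case False
  show ?thesis
    unfolding tendsto_iff_absval
  proof (intro allI impI)
    fix \<epsilon> :: real assume "\<epsilon> > 0"
    then have "\<epsilon> / absval c > 0" using False by simp
    then have "\<forall>\<^sub>F x in F. absval (f x - l) < \<epsilon> / absval c"
      using assms unfolding tendsto_iff_absval by blast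
    then show "\<forall>\<^sub>F x in F. absval (c * f x - c * l) < \<epsilon>"
      by (rule eventually_mono)
        (use False in \<open>simp add: absval_mult pos_less_divide_eq mult.commute flip: right_diff_distrib\<close>)
  qed
qed auto

lemma has_sum_cmult_ultrametric:
  fixes f :: "'i \<Rightarrow> 'c::ultrametric_field"
  assumes "(f has_sum S) A"
  shows "((\<lambda>i. c * f i) has_sum c * S) A"
  using tendsto_cmult_ultrametric[OF assms[unfolded has_sum_def], of c]
  by (simp add: has_sum_def sum_distrib_left)

lemma has_sum_diff_ultrametric:
  fixes f g :: "'i \<Rightarrow> 'c::ultrametric_field"
  assumes "(f has_sum S) A" "(g has_sum T) A"
  shows "((\<lambda>i. f i - g i) has_sum S - T) A"
  using has_sum_add[OF assms(1), of "\<lambda>i. - g i" "- T"] assms(2) by (simp add: has_sum_uminus)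

text \<open>Balls are closed, and finite sums do not leave them.\<close>

lemma has_sum_absval_le:
  fixes f :: "'i \<Rightarrow> 'c::ultrametric_field"
  assumes "(f has_sum S) A" and "0 \<le> B" and "\<And>i. i \<in> A \<Longrightarrow> absval (f i) \<le> B"
  shows "absval S \<le> B"
proof (rule ccontr)
  assume "\<not> absval S \<le> B"
  then have "absval S > 0" "B < absval S" using assms(2) by linarith+
  then have "\<forall>\<^sub>F F in finite_subsets_at_top A. absval (sum f F - S) < absval S"
    using assms(1) unfolding has_sum_def tendsto_iff_absval by blast
  then obtain F where F: "F \<subseteq> A" "absval (sum f F - S) < absval S"
    unfolding eventually_finite_subsets_at_top by blast
  have "absval (sum f F) \<le> B"
    using assms(3) F(1) by (intro absval_sum_le assms(2)) auto
  then have "absval (sum f F - (sum f F - S)) < absval S"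
    using F(2) absval_diff[of "sum f F" "sum f F - S"] \<open>B < absval S\<close> by linarith
  then show False by simp
qed

definition null_family :: "('i \<Rightarrow> 'c::ultrametric_field) \<Rightarrow> bool" where
  "null_family c \<longleftrightarrow> (\<forall>\<epsilon>>0. finite {\<nu>. absval (c \<nu>) \<ge> \<epsilon>})"

lemma null_family_mono:
  assumes "null_family c" "\<And>\<nu>. absval (d \<nu>) \<le> absval (c \<nu>)"
  shows "null_family d"
  unfolding null_family_def
proof (intro allI impI)
  fix \<epsilon> :: real assume "\<epsilon> > 0"
  then have "finite {\<nu>. absval (c \<nu>) \<ge> \<epsilon>}" using assms(1) by (simp add: null_family_def)
  then show "finite {\<nu>. absval (d \<nu>) \<ge> \<epsilon>}"
    by (rule rev_finite_subset) (use assms(2) order_trans in blast)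
qed

lemma null_family_inj:
  assumes "null_family c" "inj h"
  shows "null_family (\<lambda>\<nu>. c (h \<nu>))"
  unfolding null_family_def
proof (intro allI impI)
  fix \<epsilon> :: real assume "\<epsilon> > 0"
  then have "finite (h -` {\<nu>. absval (c \<nu>) \<ge> \<epsilon>})"
    using assms by (intro finite_vimageI) (auto simp: null_family_def)
  then show "finite {\<nu>. absval (c (h \<nu>)) \<ge> \<epsilon>}" by (simp add: vimage_def)
qed

text \<open>In an ultrametric complete field a family is summable as soon as it tends to zero: the
  partial sums over the finite sets where the terms are large form a Cauchy sequence.\<close>

lemma null_family_summable:
  fixes c :: "'i \<Rightarrow> 'c::ultrametric_field"
  assumes "complete (UNIV :: 'c set)" and "null_family c"
  shows "c summable_on UNIV"
proof -
  define F where "F = (\<lambda>n::nat. {\<nu>. absval (c \<nu>) \<ge> inverse (Suc n)})"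
  have fin: "finite (F n)" for n
    using assms(2) unfolding null_family_def F_def by simp
  have mono: "F m \<subseteq> F n" if "m \<le> n" for m n
  proof -
    have "inverse (real (Suc n)) \<le> inverse (real (Suc m))"
      using that by (intro le_imp_inverse_le) auto
    then show ?thesis unfolding F_def using order_trans by blast
  qed
  have close: "absval (sum c H - sum c (F n)) \<le> inverse (Suc n)" if "finite H" "F n \<subseteq> H" for H n
  proof -
    have "sum c H - sum c (F n) = sum c (H - F n)"
      using that fin by (simp add: sum_diff)
    then show ?thesis
      by (auto simp: F_def intro!: absval_sum_le)
  qed
  have "Cauchy (\<lambda>n. sum c (F n))"
  proof (rule metric_CauchyI)
    fix \<epsilon> :: real assume "\<epsilon> > 0"
    then obtain N where N: "inverse (Suc N) < \<epsilon>" using reals_Archimedean by blast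
    have "absval (sum c (F m) - sum c (F n)) < \<epsilon>" if "m \<ge> N" "n \<ge> N" for m n
    proof -
      have "absval ((sum c (F m) - sum c (F N)) - (sum c (F n) - sum c (F N))) \<le> inverse (Suc N)"
        using that by (intro absval_diff_le close fin mono)
      then show ?thesis using N by simp
    qed
    then show "\<exists>M. \<forall>m\<ge>M. \<forall>n\<ge>M. dist (sum c (F m)) (sum c (F n)) < \<epsilon>"
      unfolding dist_absval by blast
  qed
  then obtain S where S: "(\<lambda>n. sum c (F n)) \<longlonglongrightarrow> S"
    using assms(1) unfolding complete_def by auto
  have "(sum c \<longlongrightarrow> S) (finite_subsets_at_top UNIV)"
    unfolding tendsto_iff_absval
  proof (intro allI impI)
    fix \<epsilon> :: real assume "\<epsilon> > 0"
    then obtain N where N: "inverse (Suc N) < \<epsilon>" using reals_Archimedean by blast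
    have "\<forall>\<^sub>F n in sequentially. absval (sum c (F n) - S) < \<epsilon>"
      using S \<open>\<epsilon> > 0\<close> unfolding tendsto_iff_absval by blast
    then obtain n where n: "n \<ge> N" "absval (sum c (F n) - S) < \<epsilon>"
      unfolding eventually_sequentially by (meson max.cobounded1 max.cobounded2)
    have "absval (sum c H - S) < \<epsilon>" if "finite H" "F n \<subseteq> H" for H
    proof -
      have "inverse (real (Suc n)) \<le> inverse (Suc N)" using n(1) by (simp add: le_imp_inverse_le)
      then have "absval (sum c H - sum c (F n)) < \<epsilon>" using close[OF that] N by linarith
      then have "absval ((sum c H - sum c (F n)) + (sum c (F n) - S)) < \<epsilon>"
        using n(2) absval_add[of "sum c H - sum c (F n)" "sum c (F n) - S"] by linarith
      then show ?thesis by simp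
    qed
    then show "\<forall>\<^sub>F H in finite_subsets_at_top UNIV. absval (sum c H - S) < \<epsilon>"
      unfolding eventually_finite_subsets_at_top using fin by (intro exI[of _ "F n"]) auto
  qed
  then show ?thesis
    unfolding summable_on_def has_sum_def by blast
qed

section \<open>The p-adic integers\<close>

lemma Zp_iff: "x \<in> Zp \<longleftrightarrow> (\<forall>\<epsilon>>0. \<exists>z::int. absval (x - of_int z) < \<epsilon>)" for x :: "'c::ultrametric_field"
  unfolding Zp_def closure_approachable Ints_def
  by (auto simp: dist_absval absval_minus_commute)

lemma of_int_in_Zp [simp]: "of_int z \<in> Zp"
  unfolding Zp_def using closure_subset Ints_of_int by blast

lemma of_nat_in_Zp [simp]: "of_nat n \<in> Zp"
  using of_int_in_Zp[of "int n"] by simp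

lemma zero_in_Zp [simp]: "0 \<in> Zp" and one_in_Zp [simp]: "1 \<in> Zp"
  using of_int_in_Zp[of 0] of_int_in_Zp[of 1] by simp_all

lemma absval_Zp: 
  assumes "x \<in> Zp" 
  shows "absval x \<le> 1"
proof -
  obtain z :: int where "absval (x - of_int z) < 1" using assms unfolding Zp_iff by (metis zero_less_one)
  then have "absval ((x - of_int z) + of_int z) \<le> 1"
    by (intro absval_add_le absval_of_int_le_1) simp
  then show ?thesis by simp
qed

lemma Zp_add: 
  assumes "x \<in> Zp" "y \<in> Zp"
  shows "x + y \<in> Zp"
  unfolding Zp_iff
proof (intro allI impI)
  fix \<epsilon> :: real assume "\<epsilon> > 0"
  then obtain z w :: int where "absval (x - of_int z) < \<epsilon>" "absval (y - of_int w) < \<epsilon>"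
    using assms unfolding Zp_iff by blast
  then have "absval ((x - of_int z) + (y - of_int w)) < \<epsilon>"
    using absval_add[of "x - of_int z" "y - of_int w"] by linarith
  then show "\<exists>u::int. absval (x + y - of_int u) < \<epsilon>"
    by (intro exI[of _ "z + w"]) (simp add: algebra_simps)
qed

lemma Zp_mult: 
  assumes "x \<in> Zp" "y \<in> Zp"
  shows "x * y \<in> Zp"
  unfolding Zp_iff
proof (intro allI impI)
  fix \<epsilon> :: real assume "\<epsilon> > 0"
  then obtain z w :: int where zw: "absval (x - of_int z) < \<epsilon>" "absval (y - of_int w) < \<epsilon>"
    using assms unfolding Zp_iff by blast
  have "absval (x * (y - of_int w)) < \<epsilon>"
    using mult_mono[OF absval_Zp[OF assms(1)] order_refl[of "absval (y - of_int w)"]] zw(2)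
    by (simp add: absval_mult)
  moreover have "absval ((x - of_int z) * of_int w) < \<epsilon>"
    using mult_mono[OF order_refl[of "absval (x - of_int z)"] absval_of_int_le_1[of w, where 'c='a]] zw(1)
    by (simp add: absval_mult)
  ultimately have "absval (x * (y - of_int w) + (x - of_int z) * of_int w) < \<epsilon>"
    using absval_add[of "x * (y - of_int w)" "(x - of_int z) * of_int w"] by linarith
  then show "\<exists>u::int. absval (x * y - of_int u) < \<epsilon>"
    by (intro exI[of _ "z * w"]) (simp add: algebra_simps)
qed

lemma M2_mult: "X \<in> M2 Zp \<Longrightarrow> Y \<in> M2 Zp \<Longrightarrow> X ** Y \<in> M2 Zp"
  unfolding M2_def by (auto simp: matrix_matrix_mult_def UNIV_2 intro!: Zp_add Zp_mult)

text \<open>If both \<open>z\<close> and \<open>p\<close> had absolute value less than \<open>1\<close>, a Bezout relation would give the same for \<open>1\<close>.\<close>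
lemma absval_of_int_coprime:
  fixes z :: int
  assumes "prime p" "absval (of_nat p :: 'c::ultrametric_field) = 1 / real p" "\<not> int p dvd z"
  shows "absval (of_int z :: 'c) = 1"
proof (rule ccontr)
  assume ne: "absval (of_int z :: 'c) \<noteq> 1"
  then have z: "absval (of_int z :: 'c) < 1" using absval_of_int_le_1[of z, where 'c='c] by linarith
  have "coprime (int p) z" using assms(1,3) by (simp add: prime_imp_coprime)
  then obtain u v where uv: "u * int p + v * z = 1"
    by (metis bezout_int coprime_iff_gcd_eq_1)
  have p1: "1 / real p < 1" using prime_gt_1_nat[OF assms(1)] by simp
  have "absval (of_int u * of_nat p :: 'c) < 1"
    using mult_mono[OF absval_of_int_le_1[of u, where 'c='c] order_refl[of "1 / real p"]] p1
    by (simp add: absval_mult assms(2))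
  moreover have "absval (of_int v * of_int z :: 'c) < 1"
    using mult_mono[OF absval_of_int_le_1[of v, where 'c='c] order_refl[of "absval (of_int z :: 'c)"]] z
    by (simp add: absval_mult)
  moreover have "of_int u * of_nat p + of_int v * of_int z = (1::'c)"
    using arg_cong[OF uv, of "of_int :: int \<Rightarrow> 'c"] by simp
  ultimately show False
    using absval_add[of "of_int u * of_nat p :: 'c" "of_int v * of_int z"] by simp
qed

text \<open>By the normalisation of the absolute value, its restriction to the integers is the \<open>p\<close>-adic one.\<close>
lemma power_dvd_if_absval_le:
  fixes z :: int
  assumes "prime p" "absval (of_nat p :: 'c::ultrametric_field) = 1 / real p"
    and "absval (of_int z :: 'c) \<le> 1 / real p ^ n"
  shows "int p ^ n dvd z"
  using assms(3)
proof (induction n arbitrary: z)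
  case (Suc n)
  have p: "real p > 1" using prime_gt_1_nat[OF assms(1)] by simp
  then have "1 / real p ^ Suc n < 1"
    by (meson divide_less_eq_1_pos one_less_power order_less_trans zero_less_Suc zero_less_one)
  then have "absval (of_int z :: 'c) \<noteq> 1" using Suc.prems by linarith
  then obtain w where w: "z = int p * w"
    using absval_of_int_coprime[OF assms(1,2)] by blast
  have "absval (of_int w :: 'c) \<le> 1 / real p ^ n"
    using Suc.prems p by (simp add: w absval_mult assms(2) field_simps)
  then show ?case using Suc.IH w by simp
qed simp

text \<open>An integer near \<open>x\<close> is as small as \<open>x\<close>, hence divisible by \<open>p^n\<close>; its quotient approximates
  \<open>x / p^n\<close>.\<close>
lemma Zp_divide_power:
  fixes x :: "'c::ultrametric_field"
  assumes "prime p" "absval (of_nat p :: 'c) = 1 / real p"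
    and "x \<in> Zp" "absval x \<le> 1 / real p ^ n"
  shows "x / of_nat p ^ n \<in> Zp"
  unfolding Zp_iff
proof (intro allI impI)
  have p: "real p > 0" "of_nat p \<noteq> (0::'c)" using prime_gt_0_nat[OF assms(1)] by simp_all
  fix \<epsilon> :: real assume "\<epsilon> > 0"
  then have "min \<epsilon> 1 / real p ^ n > 0" using p by simp
  then obtain z :: int where z: "absval (x - of_int z) < min \<epsilon> 1 / real p ^ n"
    using assms(3) unfolding Zp_iff by blast
  then have "absval (x - of_int z) \<le> 1 / real p ^ n"
    using p by (smt (verit, best) divide_right_mono min.cobounded2 zero_le_power)
  then have "absval (x - (x - of_int z)) \<le> 1 / real p ^ n"
    using absval_diff_le[OF assms(4)] by blast
  then have "absval (of_int z :: 'c) \<le> 1 / real p ^ n"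
    by (simp only: diff_diff_eq2 add_diff_cancel_left')
  then have "int p ^ n dvd z"
    by (rule power_dvd_if_absval_le[OF assms(1,2)])
  then obtain w where w: "z = int p ^ n * w" by blast
  have "absval ((x - of_int z) / of_nat p ^ n) < min \<epsilon> 1"
    using z p by (simp add: absval_divide absval_power assms(2) field_simps)
  moreover have "(x - of_int z) / of_nat p ^ n = x / of_nat p ^ n - of_int w"
    using p by (simp add: w field_simps)
  ultimately show "\<exists>u::int. absval (x / of_nat p ^ n - of_int u) < \<epsilon>"
    by (intro exI[of _ w]) auto
qed

lemma tendsto_p_power_0:
  assumes "prime p" "absval (of_nat p :: 'c::ultrametric_field) = 1 / real p"
  shows "(\<lambda>n. of_nat p ^ n :: 'c) \<longlonglongrightarrow> 0"
proof -
  have "(\<lambda>n. (1 / real p) ^ n) \<longlonglongrightarrow> 0"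
    using prime_gt_1_nat[OF assms(1)] by (intro LIMSEQ_realpow_zero) auto
  then show ?thesis
    unfolding tendsto_iff_absval
    by (auto simp: absval_power assms(2) tendsto_iff dist_real_def)
qed

lemma at_0_within_Zp_neq_bot:
  assumes "prime p" "absval (of_nat p :: 'c::ultrametric_field) = 1 / real p"
  shows "at 0 within (Zp :: 'c set) \<noteq> bot"
proof -
  have "(of_nat p ^ n :: 'c) \<in> Zp - {0}" for n
    using prime_gt_0_nat[OF assms(1)] of_nat_in_Zp[of "p ^ n", where 'a='c] by simp
  then have "(0::'c) islimpt Zp"
    unfolding islimpt_sequential using tendsto_p_power_0[OF assms] by blast
  then show ?thesis by (simp add: trivial_limit_within)
qed

section \<open>Convergence in the ring of functions on the perfectoid disc\<close>

text \<open>The supremum in \<open>gauss_norm\<close> is meaningful only under this condition; otherwise it is an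
  arbitrary real number.\<close>
definition gauss_bounded :: "real \<Rightarrow> (rat \<Rightarrow> 'c::ultrametric_field) \<Rightarrow> bool" where
  "gauss_bounded r a \<longleftrightarrow> (\<exists>M. \<forall>s. absval (a s) * r powr real_of_rat s \<le> M)"

lemma gauss_norm_upper:
  "gauss_bounded r a \<Longrightarrow> absval (a s) * r powr real_of_rat s \<le> gauss_norm r a"
  unfolding gauss_bounded_def gauss_norm_def by (rule cSUP_upper) (auto simp: bdd_above_def)

lemma gauss_norm_least:
  "(\<And>s. absval (a s) * r powr real_of_rat s \<le> M) \<Longrightarrow> gauss_norm r a \<le> M"
  unfolding gauss_norm_def by (rule cSUP_least) auto

lemma gauss_bounded_diff:
  assumes "gauss_bounded r a" "gauss_bounded r b"
  shows "gauss_bounded r (\<lambda>s. a s - b s)"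
    and "gauss_norm r (\<lambda>s. a s - b s) \<le> max (gauss_norm r a) (gauss_norm r b)"
proof -
  have *: "absval (a s - b s) * r powr real_of_rat s \<le> max (gauss_norm r a) (gauss_norm r b)" for s
  proof -
    have "absval (a s - b s) * r powr real_of_rat s
        \<le> max (absval (a s)) (absval (b s)) * r powr real_of_rat s"
      by (intro mult_right_mono absval_diff) auto
    also have "\<dots> \<le> max (gauss_norm r a) (gauss_norm r b)"
      using gauss_norm_upper[OF assms(1), of s] gauss_norm_upper[OF assms(2), of s]
      by (auto simp: max_def)
    finally show ?thesis .
  qed
  show "gauss_bounded r (\<lambda>s. a s - b s)" using * unfolding gauss_bounded_def by blast
  show "gauss_norm r (\<lambda>s. a s - b s) \<le> max (gauss_norm r a) (gauss_norm r b)"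
    by (rule gauss_norm_least) (rule *)
qed

lemma gauss_bounded_cmult:
  assumes "gauss_bounded r a"
  shows "gauss_bounded r (\<lambda>s. k * a s)"
proof -
  obtain M where "\<And>s. absval (a s) * r powr real_of_rat s \<le> M"
    using assms unfolding gauss_bounded_def by blast
  then have "absval (k * a s) * r powr real_of_rat s \<le> absval k * M" for s
    using mult_left_mono[of "absval (a s) * r powr real_of_rat s" M "absval k"]
    by (simp add: absval_mult mult.assoc)
  then show ?thesis unfolding gauss_bounded_def by blast
qed

lemma gauss_bounded_sum:
  "(\<And>i. i \<in> F \<Longrightarrow> gauss_bounded r (a i)) \<Longrightarrow> gauss_bounded r (\<lambda>s. \<Sum>i\<in>F. a i s)"
proof (induction F rule: infinite_finite_induct)
  case (insert i F)
  have "gauss_bounded r (\<lambda>s. a i s - (-1) * (\<Sum>i\<in>F. a i s))"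
    using insert by (intro gauss_bounded_diff gauss_bounded_cmult) auto
  with insert show ?case by simp
qed (auto simp: gauss_bounded_def)

text \<open>Beyond some exponent the terms are below \<open>1\<close>; before it, only finitely many coefficients exceed
  \<open>1\<close>, and negative exponents do not occur.\<close>
lemma OD_gauss_bounded:
  assumes "a \<in> OD p" "0 < r" "r < 1"
  shows "gauss_bounded r a"
proof -
  have "((\<lambda>s. absval (a s) * r powr real_of_rat s) \<longlongrightarrow> 0) at_top"
    using assms by (auto simp: OD_def)
  then have "\<forall>\<^sub>F s in at_top. absval (a s) * r powr real_of_rat s < 1"
    by (rule order_tendstoD) simp
  then obtain S where S: "\<And>s. s \<ge> S \<Longrightarrow> absval (a s) * r powr real_of_rat s < 1"
    unfolding eventually_at_top_linorder by blast
  define B where "B = {s. 0 \<le> s \<and> s \<le> S \<and> absval (a s) > 1}"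
  have fin: "finite B" using assms(1) unfolding OD_def B_def by auto
  define M where "M = Max (insert 1 ((\<lambda>s. absval (a s) * r powr real_of_rat s) ` B))"
  have "absval (a s) * r powr real_of_rat s \<le> M" for s
  proof (cases "s \<in> B")
    case True
    then show ?thesis using fin unfolding M_def by (intro Max_ge) auto
  next
    case False
    have "absval (a s) * r powr real_of_rat s \<le> 1"
    proof (cases "0 \<le> s \<and> s \<le> S")
      case True
      then have "absval (a s) \<le> 1" using False unfolding B_def by auto
      moreover have "r powr real_of_rat s \<le> 1"
        using True assms by (intro powr_le1) auto
      ultimately show ?thesis by (simp add: mult_le_one)
    next
      case False
      then show ?thesis
      proof (cases "0 \<le> s")
        case True
        then show ?thesis using S[of s] False by auto
      next
        case False
        then have "a s = 0" using assms(1) unfolding OD_def exponents_def by auto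
        then show ?thesis by simp
      qed
    qed
    also have "1 \<le> M" using fin unfolding M_def by (intro Max_ge) auto
    finally show ?thesis .
  qed
  then show ?thesis unfolding gauss_bounded_def by blast
qed

text \<open>The functions on the \<open>m\<close>-th disc, in the variable \<open>q^(1/p^m)\<close>. As there are finitely many
  exponents in a bounded interval, boundedness on all smaller discs is the whole growth condition.\<close>
definition OD_level :: "nat \<Rightarrow> nat \<Rightarrow> (rat \<Rightarrow> 'c::ultrametric_field) set" where
  "OD_level p m = {a. (\<forall>s. a s \<noteq> 0 \<longrightarrow> 0 \<le> s \<and> s * of_nat p ^ m \<in> \<int>) \<and>
     (\<forall>r. 0 < r \<and> r < 1 \<longrightarrow> gauss_bounded r a)}"

text \<open>Boundedness at a radius \<open>t\<close> with \<open>r < t < 1\<close> gives decay at \<open>r\<close>.\<close>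
lemma OD_level_subset_OD:
  assumes "p > 0"
  shows "OD_level p m \<subseteq> (OD p :: (rat \<Rightarrow> 'c::ultrametric_field) set)"
proof
  fix a :: "rat \<Rightarrow> 'c" assume a: "a \<in> OD_level p m"
  show "a \<in> OD p"
    unfolding OD_def
  proof (intro CollectI conjI allI impI)
    fix s :: rat assume "s \<notin> exponents p"
    then show "a s = 0" using a unfolding OD_level_def exponents_def by auto
  next
    fix r :: real assume r: "0 \<le> r \<and> r < 1"
    show "((\<lambda>s. absval (a s) * r powr real_of_rat s) \<longlongrightarrow> 0) at_top"
    proof (cases "r = 0")
      case False
      define t where "t = (r + 1) / 2"
      have t: "r < t" "0 < t" "t < 1" "r > 0" using r False unfolding t_def by auto
      then have "gauss_bounded t a" using a unfolding OD_level_def by blast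
      then obtain M where M: "\<And>s. absval (a s) * t powr real_of_rat s \<le> M"
        unfolding gauss_bounded_def by blast
      have "M \<ge> 0" by (rule order_trans[OF _ M[of 0]]) simp
      have lim: "((\<lambda>s::rat. M * (r / t) powr real_of_rat s) \<longlongrightarrow> 0) at_top"
      proof -
        have "((\<lambda>x::real. (r / t) powr x) \<longlongrightarrow> 0) at_top"
        proof -
          have "ln (r / t) < 0" using t by simp
          then have "filterlim (\<lambda>x::real. ln (r / t) * x) at_bot at_top"
            by (intro filterlim_tendsto_neg_mult_at_bot[OF tendsto_const _ filterlim_ident])
          then have "((\<lambda>x::real. exp (ln (r / t) * x)) \<longlongrightarrow> 0) at_top"
            by (rule filterlim_compose[OF exp_at_bot])
          then show ?thesis using t by (simp add: powr_def mult.commute)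
        qed
        moreover have "filterlim (real_of_rat) at_top at_top"
          unfolding filterlim_at_top
        proof
          fix Z :: real
          show "\<forall>\<^sub>F x in at_top. Z \<le> real_of_rat x"
            using eventually_ge_at_top[of "of_int \<lceil>Z\<rceil> :: rat"]
          proof (rule eventually_mono)
            fix x :: rat assume "of_int \<lceil>Z\<rceil> \<le> x"
            then have "real_of_rat (of_int \<lceil>Z\<rceil>) \<le> real_of_rat x" by (simp only: of_rat_less_eq)
            then show "Z \<le> real_of_rat x" unfolding of_rat_of_int_eq by linarith
          qed
        qed
        ultimately have "((\<lambda>s::rat. (r / t) powr real_of_rat s) \<longlongrightarrow> 0) at_top"
          by (rule filterlim_compose)
        then show ?thesis by (rule tendsto_mult_right_zero)
      qed
      have "absval (a s) * r powr real_of_rat s \<le> M * (r / t) powr real_of_rat s" for s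
      proof -
        have "r powr real_of_rat s = t powr real_of_rat s * (r / t) powr real_of_rat s"
          using t by (simp flip: powr_mult)
        then show ?thesis
          using mult_right_mono[OF M[of s], of "(r / t) powr real_of_rat s"] by (simp add: mult.assoc)
      qed
      then show ?thesis
        by (intro tendsto_sandwich[OF _ _ tendsto_const lim]) auto
    qed simp
  next
    fix \<delta> :: real and l u :: rat assume "\<delta> > 0"
    define P where "P = (of_nat p ^ m :: rat)"
    have P: "P > 0" using assms unfolding P_def by simp
    have "{s. l \<le> s \<and> s \<le> u \<and> absval (a s) > \<delta>} \<subseteq> (\<lambda>z. of_int z / P) ` {\<lfloor>l * P\<rfloor>..\<lceil>u * P\<rceil>}"
    proof safe
      fix s assume s: "l \<le> s" "s \<le> u" "absval (a s) > \<delta>"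
      then have "a s \<noteq> 0" using \<open>\<delta> > 0\<close> by auto
      then have "s * P \<in> \<int>" using a unfolding OD_level_def P_def by blast
      then obtain z where z: "s * P = of_int z" by (rule Ints_cases)
      have "l * P \<le> of_int z" "of_int z \<le> u * P"
        unfolding z[symmetric] using s P by (auto intro: mult_right_mono)
      then have "z \<in> {\<lfloor>l * P\<rfloor>..\<lceil>u * P\<rceil>}" by (auto simp: floor_le_iff le_ceiling_iff)
      moreover have "s = of_int z / P" unfolding z[symmetric] using P by simp
      ultimately show "s \<in> (\<lambda>z. of_int z / P) ` {\<lfloor>l * P\<rfloor>..\<lceil>u * P\<rceil>}" by blast
    qed
    then show "finite {s. l \<le> s \<and> s \<le> u \<and> absval (a s) > \<delta>}"
      by (rule finite_subset) simp
  qed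
qed

lemma topspace_OD: "topspace (OD_topology p) = (OD p :: (rat \<Rightarrow> 'c::ultrametric_field) set)"
  unfolding OD_topology_def topology_generated_by_topspace
proof (intro subset_antisym subsetI)
  fix a :: "rat \<Rightarrow> 'c" assume a: "a \<in> OD p"
  show "a \<in> \<Union> {{b \<in> OD p. gauss_norm r (\<lambda>s. b s - a s) < \<epsilon>} | a r \<epsilon>.
      a \<in> OD p \<and> 0 < r \<and> r < 1 \<and> 0 < \<epsilon>}"
  proof (rule UnionI)
    show "{b \<in> OD p. gauss_norm (1/2) (\<lambda>s. b s - a s) < 1} \<in>
       {{b \<in> OD p. gauss_norm r (\<lambda>s. b s - a s) < \<epsilon>} | a r \<epsilon>.
         a \<in> OD p \<and> 0 < r \<and> r < 1 \<and> 0 < \<epsilon>}"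
      using a by (intro CollectI exI[of _ a] exI[of _ "1/2"] exI[of _ 1]) auto
    show "a \<in> {b \<in> OD p. gauss_norm (1/2) (\<lambda>s. b s - a s) < 1}"
      using a by (simp add: gauss_norm_def)
  qed
qed auto

text \<open>The balls of the defining subbasis need not be centred at the limit; the ultrametric
  inequality makes every point of a ball a centre.\<close>

lemma limitin_OD_iff:
  fixes l :: "rat \<Rightarrow> 'c::ultrametric_field"
  shows "limitin (OD_topology p) \<psi> l F \<longleftrightarrow> l \<in> OD p \<and>
    (\<forall>r \<epsilon>. 0 < r \<and> r < 1 \<and> 0 < \<epsilon> \<longrightarrow>
      (\<forall>\<^sub>F t in F. \<psi> t \<in> OD p \<and> gauss_norm r (\<lambda>s. \<psi> t s - l s) < \<epsilon>))"
    (is "?L \<longleftrightarrow> l \<in> OD p \<and> ?R")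
proof (intro iffI conjI)
  assume L: ?L
  show l: "l \<in> OD p" using limitin_topspace[OF L] unfolding topspace_OD .
  show ?R
  proof (intro allI impI)
    fix r \<epsilon> :: real assume r: "0 < r \<and> r < 1 \<and> 0 < \<epsilon>"
    let ?B = "{b \<in> OD p. gauss_norm r (\<lambda>s. b s - l s) < \<epsilon>}"
    have "openin (OD_topology p) ?B"
      unfolding OD_topology_def
      by (rule topology_generated_by_Basis, intro CollectI exI[of _ l] exI[of _ r] exI[of _ \<epsilon>])
        (use r l in auto)
    moreover have "l \<in> ?B" using r l by (simp add: gauss_norm_def)
    ultimately have "\<forall>\<^sub>F t in F. \<psi> t \<in> ?B" by (rule limitinD[OF L])
    then show "\<forall>\<^sub>F t in F. \<psi> t \<in> OD p \<and> gauss_norm r (\<lambda>s. \<psi> t s - l s) < \<epsilon>" by simp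
  qed
next
  assume R: "l \<in> OD p \<and> ?R"
  let ?S = "{{b \<in> OD p. gauss_norm r (\<lambda>s. b s - a s) < \<epsilon>} | a r \<epsilon>.
      a \<in> OD p \<and> 0 < r \<and> r < 1 \<and> 0 < \<epsilon>} :: (rat \<Rightarrow> 'c) set set"
  have "\<forall>\<^sub>F t in F. \<psi> t \<in> W" if "generate_topology_on ?S W" "l \<in> W" for W
    using that
  proof (induction rule: generate_topology_on.induct)
    case (Int a b)
    then show ?case by (auto intro: eventually_conj)
  next
    case (UN K)
    then obtain k where "k \<in> K" "l \<in> k" by blast
    with UN.IH have "\<forall>\<^sub>F t in F. \<psi> t \<in> k" by blast
    then show ?case by (rule eventually_mono) (use \<open>k \<in> K\<close> in blast)
  next
    case (Basis W)
    then obtain a r \<epsilon> where W: "W = {b \<in> OD p. gauss_norm r (\<lambda>s. b s - a s) < \<epsilon>}"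
      and a: "a \<in> OD p" "0 < r" "r < 1" "0 < \<epsilon>" by auto
    have la: "gauss_norm r (\<lambda>s. l s - a s) < \<epsilon>" using Basis(2) unfolding W by simp
    have "\<forall>\<^sub>F t in F. \<psi> t \<in> OD p \<and> gauss_norm r (\<lambda>s. \<psi> t s - l s) < \<epsilon>" using R a by blast
    then show ?case
    proof (rule eventually_mono)
      fix t assume t: "\<psi> t \<in> OD p \<and> gauss_norm r (\<lambda>s. \<psi> t s - l s) < \<epsilon>"
      have bd: "gauss_bounded r b" if "b \<in> OD p" for b :: "rat \<Rightarrow> 'c"
        using OD_gauss_bounded[OF that] a by simp
      have neg: "gauss_norm r (\<lambda>s. a s - l s) = gauss_norm r (\<lambda>s. l s - a s)"
        unfolding gauss_norm_def by (simp add: absval_minus_commute)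
      have "gauss_norm r (\<lambda>s. (\<psi> t s - l s) - (a s - l s))
          \<le> max (gauss_norm r (\<lambda>s. \<psi> t s - l s)) (gauss_norm r (\<lambda>s. a s - l s))"
        using t a R by (intro gauss_bounded_diff bd) auto
      then have "gauss_norm r (\<lambda>s. \<psi> t s - a s)
          \<le> max (gauss_norm r (\<lambda>s. \<psi> t s - l s)) (gauss_norm r (\<lambda>s. l s - a s))"
        by (simp add: neg)
      then have "gauss_norm r (\<lambda>s. \<psi> t s - a s) < \<epsilon>" using t la by linarith
      then show "\<psi> t \<in> W" using t W by simp
    qed
  qed auto
  then have "\<forall>W. openin (OD_topology p) W \<and> l \<in> W \<longrightarrow> (\<forall>\<^sub>F t in F. \<psi> t \<in> W)"
    unfolding OD_topology_def openin_topology_generated_by_iff by blast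
  then show ?L
    using R unfolding limitin_def topspace_OD by blast
qed

text \<open>A Gauss norm bounds every single coefficient, so limits are determined coefficientwise.\<close>
lemma limitin_OD_unique:
  fixes l l' :: "rat \<Rightarrow> 'c::ultrametric_field"
  assumes "limitin (OD_topology p) \<psi> l F" "limitin (OD_topology p) \<psi> l' F" "F \<noteq> bot"
  shows "l = l'"
proof (rule ext, rule ccontr)
  fix s assume ne: "l s \<noteq> l' s"
  have bd: "gauss_bounded (1/2) b" if "b \<in> OD p" for b :: "rat \<Rightarrow> 'c"
    using OD_gauss_bounded[OF that] by simp
  define \<epsilon> where "\<epsilon> = absval (l s - l' s) * (1/2) powr real_of_rat s"
  have "\<epsilon> > 0" using ne unfolding \<epsilon>_def by simp
  have ll: "l \<in> OD p" "l' \<in> OD p" using assms by (auto simp: limitin_OD_iff)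
  have "\<forall>\<^sub>F t in F. \<psi> t \<in> OD p \<and> gauss_norm (1/2) (\<lambda>s. \<psi> t s - l s) < \<epsilon>"
    and "\<forall>\<^sub>F t in F. \<psi> t \<in> OD p \<and> gauss_norm (1/2) (\<lambda>s. \<psi> t s - l' s) < \<epsilon>"
    using assms(1,2) \<open>\<epsilon> > 0\<close> unfolding limitin_OD_iff by auto
  then have "\<forall>\<^sub>F t in F. \<psi> t \<in> OD p \<and> gauss_norm (1/2) (\<lambda>s. \<psi> t s - l s) < \<epsilon> \<and>
      gauss_norm (1/2) (\<lambda>s. \<psi> t s - l' s) < \<epsilon>"
    by eventually_elim auto
  then obtain t where t: "\<psi> t \<in> OD p" "gauss_norm (1/2) (\<lambda>s. \<psi> t s - l s) < \<epsilon>"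
      "gauss_norm (1/2) (\<lambda>s. \<psi> t s - l' s) < \<epsilon>"
    using eventually_happens'[OF assms(3)] by blast
  have b1: "gauss_bounded (1/2) (\<lambda>s. \<psi> t s - l s)" "gauss_bounded (1/2) (\<lambda>s. \<psi> t s - l' s)"
    using t ll by (auto intro: gauss_bounded_diff bd)
  have "\<epsilon> \<le> gauss_norm (1/2) (\<lambda>s. (\<psi> t s - l' s) - (\<psi> t s - l s))"
    using gauss_norm_upper[OF gauss_bounded_diff(1)[OF b1(2,1)], of s]
    unfolding \<epsilon>_def by simp
  also have "\<dots> < \<epsilon>"
    using gauss_bounded_diff(2)[OF b1(2,1)] t by linarith
  finally show False by simp
qed

lemma deriv_0_eqI:
  fixes l :: "rat \<Rightarrow> 'c::ultrametric_field"
  assumes "prime p" "absval (of_nat p :: 'c) = 1 / real p"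
    and "limitin (OD_topology p) (\<lambda>t s. (\<psi> t s - \<psi> 0 s) / t) l (at 0 within Zp)"
  shows "deriv_0 p \<psi> = l"
  unfolding deriv_0_def
  by (rule the_equality)
    (use assms limitin_OD_unique[OF _ _ at_0_within_Zp_neq_bot[OF assms(1,2)]] in blast)+

section \<open>Power series in two p-adic variables\<close>

type_synonym 'c coeffs = "nat \<times> nat \<Rightarrow> 'c"

definition series :: "'c::ultrametric_field coeffs \<Rightarrow> 'c \<Rightarrow> 'c \<Rightarrow> 'c" where
  "series c x y = (\<Sum>\<^sub>\<infinity>(i,l)\<in>UNIV. c (i,l) * (x ^ i * y ^ l))"

definition dx_coeffs :: "'c::ultrametric_field coeffs \<Rightarrow> 'c coeffs" where
  "dx_coeffs c = (\<lambda>(i,l). of_nat (Suc i) * c (Suc i, l))"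

definition dy_coeffs :: "'c::ultrametric_field coeffs \<Rightarrow> 'c coeffs" where
  "dy_coeffs c = (\<lambda>(i,l). of_nat (Suc l) * c (i, Suc l))"

lemma null_family_dx: "null_family c \<Longrightarrow> null_family (dx_coeffs c)"
  by (rule null_family_mono[OF null_family_inj[of c "\<lambda>(i,l). (Suc i, l)"]])
    (auto simp: dx_coeffs_def inj_on_def absval_mult intro!: mult_left_le_one_le absval_of_nat_le_1
      simp del: of_nat_Suc)

lemma null_family_dy: "null_family c \<Longrightarrow> null_family (dy_coeffs c)"
  by (rule null_family_mono[OF null_family_inj[of c "\<lambda>(i,l). (i, Suc l)"]])
    (auto simp: dy_coeffs_def inj_on_def absval_mult intro!: mult_left_le_one_le absval_of_nat_le_1
      simp del: of_nat_Suc)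

lemma absval_term_le:
  fixes x y :: "'c::ultrametric_field"
  assumes "absval x \<le> 1" "absval y \<le> 1"
  shows "absval (c * (x ^ i * y ^ l)) \<le> absval c"
  using absval_mult_le_1[OF absval_power_le_1[OF assms(1)] absval_power_le_1[OF assms(2)], of i l]
  unfolding absval_mult[of c] by (intro mult_left_le) auto

lemma has_sum_series:
  fixes c :: "'c::ultrametric_field coeffs"
  assumes "complete (UNIV :: 'c set)" "null_family c" "absval x \<le> 1" "absval y \<le> 1"
  shows "((\<lambda>(i,l). c (i,l) * (x ^ i * y ^ l)) has_sum series c x y) UNIV"
proof -
  have "null_family (\<lambda>(i,l). c (i,l) * (x ^ i * y ^ l))"
    by (rule null_family_mono[OF assms(2)]) (auto intro: absval_term_le assms)
  then show ?thesis
    unfolding series_def by (intro has_sum_infsum null_family_summable assms(1))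
qed

lemma absval_series_le:
  fixes c :: "'c::ultrametric_field coeffs"
  assumes "complete (UNIV :: 'c set)" "null_family c" "absval x \<le> 1" "absval y \<le> 1"
    and "0 \<le> B" "\<And>\<nu>. absval (c \<nu>) \<le> B"
  shows "absval (series c x y) \<le> B"
  using has_sum_series[OF assms(1-4)] assms(5)
  by (rule has_sum_absval_le) (auto intro: order_trans[OF absval_term_le] assms)

lemma series_cmult:
  fixes c :: "'c::ultrametric_field coeffs"
  assumes "complete (UNIV :: 'c set)" "null_family c" "absval x \<le> 1" "absval y \<le> 1"
  shows "series (\<lambda>\<nu>. k * c \<nu>) x y = k * series c x y"
  using infsumI[OF has_sum_cmult_ultrametric[OF has_sum_series[OF assms], of k]]
  by (simp add: series_def case_prod_unfold mult.assoc)

lemma has_sum_series_dx: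
  fixes c :: "'c::ultrametric_field coeffs"
  assumes "complete (UNIV :: 'c set)" "null_family c" "absval x \<le> 1" "absval y \<le> 1"
  shows "((\<lambda>(i,l). c (i,l) * (of_nat i * x ^ (i - 1) * y ^ l)) has_sum series (dx_coeffs c) x y) UNIV"
proof -
  let ?h = "\<lambda>(i::nat, l::nat). (Suc i, l)"
  let ?t = "\<lambda>(i,l). c (i,l) * (of_nat i * x ^ (i - 1) * y ^ l)"
  have "((?t \<circ> ?h) has_sum series (dx_coeffs c) x y) UNIV"
    using has_sum_series[OF assms(1) null_family_dx[OF assms(2)] assms(3,4)]
    by (simp add: dx_coeffs_def o_def case_prod_unfold mult.assoc mult.left_commute del: of_nat_Suc)
  then have "(?t has_sum series (dx_coeffs c) x y) (range ?h)"
    by (subst has_sum_reindex) (auto simp: inj_on_def)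
  moreover have "?t \<nu> = 0" if "\<nu> \<notin> range ?h" for \<nu>
    using that by (cases \<nu>; cases "fst \<nu>") (auto simp: image_iff)
  ultimately show ?thesis
    using has_sum_cong_neutral[of UNIV "range ?h" ?t ?t] by blast
qed

lemma has_sum_series_dy:
  fixes c :: "'c::ultrametric_field coeffs"
  assumes "complete (UNIV :: 'c set)" "null_family c" "absval x \<le> 1" "absval y \<le> 1"
  shows "((\<lambda>(i,l). c (i,l) * (x ^ i * (of_nat l * y ^ (l - 1)))) has_sum series (dy_coeffs c) x y) UNIV"
proof -
  let ?h = "\<lambda>(i::nat, l::nat). (i, Suc l)"
  let ?t = "\<lambda>(i,l). c (i,l) * (x ^ i * (of_nat l * y ^ (l - 1)))"
  have "((?t \<circ> ?h) has_sum series (dy_coeffs c) x y) UNIV"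
    using has_sum_series[OF assms(1) null_family_dy[OF assms(2)] assms(3,4)]
    by (simp add: dy_coeffs_def o_def case_prod_unfold mult.assoc mult.left_commute del: of_nat_Suc)
  then have "(?t has_sum series (dy_coeffs c) x y) (range ?h)"
    by (subst has_sum_reindex) (auto simp: inj_on_def)
  moreover have "?t \<nu> = 0" if "\<nu> \<notin> range ?h" for \<nu>
    using that by (cases \<nu>; cases "snd \<nu>") (auto simp: image_iff)
  ultimately show ?thesis
    using has_sum_cong_neutral[of UNIV "range ?h" ?t ?t] by blast
qed

lemma product_first_order:
  fixes X :: "'a::comm_ring_1"
  shows "(X + \<tau> * X' + \<tau> * \<tau> * R) * (Y + \<tau> * Y' + \<tau> * \<tau> * T) - X * Y - \<tau> * (X' * Y + X * Y')
    = \<tau> * \<tau> * (X * T + R * (Y + \<tau> * Y' + \<tau> * \<tau> * T) + X' * Y' + \<tau> * (X' * T))"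
  by (simp add: algebra_simps)

text \<open>The remainder \<open>R\<close> is a polynomial with integer coefficients in elements of the unit ball.\<close>
lemma power_first_order:
  fixes x u \<tau> :: "'c::ultrametric_field"
  assumes "absval x \<le> 1" "absval u \<le> 1" "absval \<tau> \<le> 1"
  shows "\<exists>R. absval R \<le> 1 \<and> (x + \<tau> * u) ^ i = x ^ i + \<tau> * (of_nat i * x ^ (i - 1) * u) + \<tau>\<^sup>2 * R"
proof (induction i)
  case 0
  show ?case by (rule exI[of _ 0]) simp
next
  case (Suc i)
  then obtain R where R: "absval R \<le> 1"
    "(x + \<tau> * u) ^ i = x ^ i + \<tau> * (of_nat i * x ^ (i - 1) * u) + \<tau>\<^sup>2 * R" by blast
  define R' where "R' = of_nat i * x ^ (i - 1) * u * u + x * R + \<tau> * (u * R)"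
  have "absval R' \<le> 1"
    unfolding R'_def
    by (intro absval_add_le absval_mult_le_1 absval_power_le_1 absval_of_nat_le_1 assms R(1))
  moreover have "(x + \<tau> * u) ^ Suc i = x ^ Suc i + \<tau> * (of_nat (Suc i) * x ^ (Suc i - 1) * u) + \<tau>\<^sup>2 * R'"
  proof -
    have D: "of_nat i * x ^ (i - 1) * x = of_nat i * x ^ i"
      by (cases i) simp_all
    define D where "D = of_nat i * x ^ (i - 1)"
    have "(x + \<tau> * u) ^ Suc i = (x + \<tau> * u) * (x ^ i + \<tau> * (D * u) + \<tau> * \<tau> * R)"
      unfolding power_Suc R(2) D_def power2_eq_square by simp
    also have "\<dots> = x * x ^ i + \<tau> * ((x ^ i + D * x) * u) + \<tau> * \<tau> * R'"
      unfolding R'_def D_def[symmetric] by (simp add: algebra_simps)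
    also have "x ^ i + D * x = of_nat (Suc i) * x ^ i"
      unfolding D_def D by (simp add: distrib_right)
    finally show ?thesis by (simp add: power2_eq_square)
  qed
  ultimately show ?case by blast
qed

lemma monomial_first_order:
  fixes x y u v \<tau> :: "'c::ultrametric_field"
  assumes "absval x \<le> 1" "absval u \<le> 1" "absval y \<le> 1" "absval v \<le> 1" "absval \<tau> \<le> 1"
  shows "absval ((x + \<tau> * u) ^ i * (y + \<tau> * v) ^ l - x ^ i * y ^ l
      - \<tau> * (u * (of_nat i * x ^ (i - 1) * y ^ l) + v * (x ^ i * (of_nat l * y ^ (l - 1)))))
    \<le> absval \<tau> ^ 2"
proof -
  obtain R where R: "absval R \<le> 1"
    "(x + \<tau> * u) ^ i = x ^ i + \<tau> * (of_nat i * x ^ (i - 1) * u) + \<tau>\<^sup>2 * R"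
    using power_first_order[OF assms(1,2,5)] by blast
  obtain T where T: "absval T \<le> 1"
    "(y + \<tau> * v) ^ l = y ^ l + \<tau> * (of_nat l * y ^ (l - 1) * v) + \<tau>\<^sup>2 * T"
    using power_first_order[OF assms(3,4,5)] by blast
  define X' Y' where "X' = of_nat i * x ^ (i - 1) * u" and "Y' = of_nat l * y ^ (l - 1) * v"
  define Q where "Q = x ^ i * T + R * (y + \<tau> * v) ^ l + X' * Y' + \<tau> * (X' * T)"
  have "absval Q \<le> 1"
    unfolding Q_def X'_def Y'_def
    by (intro absval_add_le absval_mult_le_1 absval_power_le_1 absval_of_nat_le_1 assms R(1) T(1))
  then have "absval (\<tau>\<^sup>2 * Q) \<le> absval \<tau> ^ 2"
    by (simp add: absval_mult absval_power mult_left_le)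
  moreover have "(x + \<tau> * u) ^ i * (y + \<tau> * v) ^ l - x ^ i * y ^ l
      - \<tau> * (u * (of_nat i * x ^ (i - 1) * y ^ l) + v * (x ^ i * (of_nat l * y ^ (l - 1)))) = \<tau>\<^sup>2 * Q"
    using product_first_order[of "x ^ i" \<tau> X' R "y ^ l" Y' T] R(2) T(2)
    by (simp add: Q_def X'_def Y'_def power2_eq_square ac_simps)
  ultimately show ?thesis by simp
qed

text \<open>All second-order remainders of the monomials have integral coefficients, so the
  remainder of the series is as small as \<open>\<tau>\<^sup>2\<close> times the largest coefficient.\<close>

lemma series_first_order:
  fixes c :: "'c::ultrametric_field coeffs"
  assumes "complete (UNIV :: 'c set)" "null_family c"
    and le: "absval x \<le> 1" "absval u \<le> 1" "absval y \<le> 1" "absval v \<le> 1" "absval \<tau> \<le> 1"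
    and "0 \<le> B" "\<And>\<nu>. absval (c \<nu>) \<le> B"
  shows "absval (series c (x + \<tau> * u) (y + \<tau> * v) - series c x y
      - \<tau> * (u * series (dx_coeffs c) x y + v * series (dy_coeffs c) x y)) \<le> absval \<tau> ^ 2 * B"
proof -
  have 1: "absval (x + \<tau> * u) \<le> 1" "absval (y + \<tau> * v) \<le> 1"
    by (intro absval_add_le absval_mult_le_1 le)+
  let ?d = "\<lambda>\<nu>. (u * (case \<nu> of (i,l) \<Rightarrow> c (i,l) * (of_nat i * x ^ (i - 1) * y ^ l))
     + v * (case \<nu> of (i,l) \<Rightarrow> c (i,l) * (x ^ i * (of_nat l * y ^ (l - 1)))))"
  let ?f = "\<lambda>\<nu>. (case \<nu> of (i,l) \<Rightarrow> c (i,l) * ((x + \<tau> * u) ^ i * (y + \<tau> * v) ^ l))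
     - (case \<nu> of (i,l) \<Rightarrow> c (i,l) * (x ^ i * y ^ l)) - \<tau> * ?d \<nu>"
  have "(?f has_sum (series c (x + \<tau> * u) (y + \<tau> * v) - series c x y
      - \<tau> * (u * series (dx_coeffs c) x y + v * series (dy_coeffs c) x y))) UNIV"
    by (intro has_sum_diff_ultrametric has_sum_cmult_ultrametric has_sum_add has_sum_series
        has_sum_series_dx has_sum_series_dy assms 1)
  then show ?thesis
  proof (rule has_sum_absval_le)
    fix \<nu> :: "nat \<times> nat"
    obtain i l where \<nu>: "\<nu> = (i,l)" by fastforce
    have eq: "?f \<nu> = c \<nu> * ((x + \<tau> * u) ^ i * (y + \<tau> * v) ^ l - x ^ i * y ^ l
      - \<tau> * (u * (of_nat i * x ^ (i - 1) * y ^ l) + v * (x ^ i * (of_nat l * y ^ (l - 1)))))"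
      unfolding \<nu> by (simp add: right_diff_distrib distrib_left mult.assoc mult.left_commute)
    show "absval (?f \<nu>) \<le> absval \<tau> ^ 2 * B"
      unfolding eq absval_mult[of "c \<nu>"] mult.commute[of "absval \<tau> ^ 2"]
      by (intro mult_mono monomial_first_order le assms) auto
  qed (use assms in simp)
qed


section \<open>Matrices\<close>

lemma mat2_nth [simp]:
  "mat2 a b c d $ 1 $ 1 = a" "mat2 a b c d $ 1 $ 2 = b" "mat2 a b c d $ 2 $ 1 = c" "mat2 a b c d $ 2 $ 2 = d"
  by (simp_all add: mat2_def)

lemma mat2_eqI: fixes X Y :: "'c^2^2"
  assumes "X$1$1 = Y$1$1" "X$1$2 = Y$1$2" "X$2$1 = Y$2$1" "X$2$2 = Y$2$2"
  shows "X = Y"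
proof (rule vec_eq_iff[THEN iffD2], rule allI)
  fix i :: 2
  show "X $ i = Y $ i"
  proof (rule vec_eq_iff[THEN iffD2], rule allI)
    fix j :: 2
    show "X $ i $ j = Y $ i $ j" using exhaust_2[of i] exhaust_2[of j] assms by metis
  qed
qed

lemma mat2_eq_iff:
  "X = Y \<longleftrightarrow> X$1$1 = Y$1$1 \<and> X$1$2 = Y$1$2 \<and> X$2$1 = Y$2$1 \<and> X$2$2 = Y$2$2" for X Y :: "'c^2^2"
  using mat2_eqI[of X Y] by blast

lemma matrix_mult_2_nth: "(X ** Y)$i$j = X$i$1 * Y$1$j + X$i$2 * Y$2$j" for X Y :: "'c::semiring_1^2^2"
  by (simp add: matrix_matrix_mult_def sum_2)

lemma mat_2_nth [simp]: "(mat 1 :: 'c::semiring_1^2^2)$1$1 = 1" "(mat 1 :: 'c::semiring_1^2^2)$1$2 = 0"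
  "(mat 1 :: 'c::semiring_1^2^2)$2$1 = 0" "(mat 1 :: 'c::semiring_1^2^2)$2$2 = 1"
  by (simp_all add: mat_def)

lemma scale_mat_nth [simp]: "scale_mat t X $ i $ j = t * X$i$j"
  by (simp add: scale_mat_def)

lemma mat2_in_M2: "a \<in> R \<Longrightarrow> b \<in> R \<Longrightarrow> c \<in> R \<Longrightarrow> d \<in> R \<Longrightarrow> mat2 a b c d \<in> M2 R"
  by (simp add: M2_def forall_2)

lemma mat_exp_unipotent: "mat_exp (scale_mat t (mat2 0 1 0 0)) = mat2 1 t 0 (1::'c::ultrametric_field)"
proof -
  let ?X = "scale_mat t (mat2 0 1 0 0) :: 'c^2^2"
  have zero: "(((**) ?X) ^^ n) (mat 1) = 0" if "n \<notin> {0, 1}" for n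
  proof -
    define m where "m = n - 2"
    then have "n = Suc (Suc m)" using that by auto
    then have "(((**) ?X) ^^ n) (mat 1) = (?X ** ?X) ** (((**) ?X) ^^ m) (mat 1)"
      by (simp add: matrix_mul_assoc)
    also have "?X ** ?X = 0" by (simp add: mat2_eq_iff matrix_mult_2_nth)
    finally show ?thesis by simp
  qed
  have "mat_exp ?X = (\<Sum>n\<in>{0,1}. scale_mat (1 / fact n) ((((**) ?X) ^^ n) (mat 1)))"
    unfolding mat_exp_def by (rule suminf_finite) (simp_all add: zero mat2_eq_iff)
  also have "\<dots> = mat2 1 t 0 1"
    by (simp add: mat2_eq_iff matrix_mult_2_nth)
  finally show ?thesis .
qed

section \<open>Sections given by power series\<close>

locale completed_field =
  fixes p :: nat and field_type :: "'c::ultrametric_field itself"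
  assumes prime: "prime p"
    and normalised: "absval (of_nat p :: 'c) = 1 / real p"
    and complete: "complete (UNIV :: 'c set)"
begin

lemma p_pos: "real p > 0" "p > 0" "(of_nat p :: 'c) \<noteq> 0" "(of_nat p :: rat) > 0"
  using prime_gt_0_nat[OF prime] by simp_all

text \<open>Coefficient families of the power series in \<open>(x, y)\<close>, with values in the functions on the \<open>n\<close>-th
  disc. For the derivatives it suffices that the family is bounded in each Gauss norm and tends to zero
  in each exponent \<open>s\<close> separately, and both conditions are easily preserved.\<close>
definition analytic_coeffs :: "nat \<Rightarrow> (nat \<times> nat \<Rightarrow> rat \<Rightarrow> 'c) \<Rightarrow> bool" where
  "analytic_coeffs n C \<longleftrightarrow>
     (\<forall>\<nu> s. C \<nu> s \<noteq> 0 \<longrightarrow> 0 \<le> s \<and> s * of_nat p ^ n \<in> \<int>) \<and>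
     (\<forall>r. 0 < r \<and> r < 1 \<longrightarrow> (\<exists>M. \<forall>\<nu> s. absval (C \<nu> s) * r powr real_of_rat s \<le> M)) \<and>
     (\<forall>s. null_family (\<lambda>\<nu>. C \<nu> s))"

definition series_at :: "(nat \<times> nat \<Rightarrow> rat \<Rightarrow> 'c) \<Rightarrow> 'c \<Rightarrow> 'c \<Rightarrow> rat \<Rightarrow> 'c" where
  "series_at C x y = (\<lambda>s. series (\<lambda>\<nu>. C \<nu> s) x y)"

text \<open>The partial derivatives and \<open>q d/dq\<close> act on the coefficients by an index shift \<open>h\<close> and by factors of
  bounded absolute value.\<close>
lemma analytic_coeffs_dominated:
  assumes "analytic_coeffs n C" 
    and "K \<ge> 0" "\<And>\<nu> s. s * of_nat p ^ n \<in> \<int> \<Longrightarrow> absval (C' \<nu> s) \<le> K * absval (C (h \<nu>) s)"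
    and "\<And>\<nu> s. s * of_nat p ^ n \<notin> \<int> \<Longrightarrow> C' \<nu> s = 0"
    and "inj h"
  shows "analytic_coeffs n C'"
  unfolding analytic_coeffs_def
proof (intro conjI allI impI)
  have le: "absval (C' \<nu> s) \<le> K * absval (C (h \<nu>) s)" for \<nu> s
    using assms(2-4) by (cases "s * of_nat p ^ n \<in> \<int>") auto
  fix \<nu> s assume ne: "C' \<nu> s \<noteq> 0"
  then have "C (h \<nu>) s \<noteq> 0" using le[of \<nu> s] by auto
  then show "0 \<le> s" "s * of_nat p ^ n \<in> \<int>" using assms(1) unfolding analytic_coeffs_def by blast+
next
  have le: "absval (C' \<nu> s) \<le> K * absval (C (h \<nu>) s)" for \<nu> s
    using assms(2-4) by (cases "s * of_nat p ^ n \<in> \<int>") auto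
  fix r :: real assume r: "0 < r \<and> r < 1"
  then obtain M where M: "\<And>\<nu> s. absval (C \<nu> s) * r powr real_of_rat s \<le> M"
    using assms(1) unfolding analytic_coeffs_def by blast
  have "absval (C' \<nu> s) * r powr real_of_rat s \<le> K * M" for \<nu> s
  proof -
    have "absval (C' \<nu> s) * r powr real_of_rat s \<le> K * (absval (C (h \<nu>) s) * r powr real_of_rat s)"
      using mult_right_mono[OF le[of \<nu> s], of "r powr real_of_rat s"] by (simp add: mult.assoc)
    also have "\<dots> \<le> K * M" by (intro mult_left_mono M assms)
    finally show ?thesis .
  qed
  then show "\<exists>M. \<forall>\<nu> s. absval (C' \<nu> s) * r powr real_of_rat s \<le> M" by blast
next
  fix s
  show "null_family (\<lambda>\<nu>. C' \<nu> s)"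
    unfolding null_family_def
  proof (intro allI impI)
    fix \<epsilon> :: real assume \<epsilon>: "\<epsilon> > 0"
    have le: "absval (C' \<nu> s) \<le> (K + 1) * absval (C (h \<nu>) s)" for \<nu>
    proof -
      have "absval (C' \<nu> s) \<le> K * absval (C (h \<nu>) s)"
        using assms(2-4) by (cases "s * of_nat p ^ n \<in> \<int>") auto
      also have "\<dots> \<le> (K + 1) * absval (C (h \<nu>) s)" by (intro mult_right_mono) auto
      finally show ?thesis .
    qed
    have "null_family (\<lambda>\<nu>. C (h \<nu>) s)"
      using assms(1) null_family_inj[OF _ assms(5)] unfolding analytic_coeffs_def by blast
    then have "finite {\<nu>. absval (C (h \<nu>) s) \<ge> \<epsilon> / (K + 1)}"
      using \<epsilon> assms(2) unfolding null_family_def by simp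
    moreover have "{\<nu>. absval (C' \<nu> s) \<ge> \<epsilon>} \<subseteq> {\<nu>. absval (C (h \<nu>) s) \<ge> \<epsilon> / (K + 1)}"
    proof
      fix \<nu> assume "\<nu> \<in> {\<nu>. absval (C' \<nu> s) \<ge> \<epsilon>}"
      then have "\<epsilon> \<le> (K + 1) * absval (C (h \<nu>) s)" using le[of \<nu>] by simp
      then show "\<nu> \<in> {\<nu>. absval (C (h \<nu>) s) \<ge> \<epsilon> / (K + 1)}"
        using assms(2) by (simp add: divide_le_eq mult.commute)
    qed
    ultimately show "finite {\<nu>. absval (C' \<nu> s) \<ge> \<epsilon>}" by (rule rev_finite_subset)
  qed
qed

lemma series_at_in_OD_level:
  assumes "analytic_coeffs n C" "absval x \<le> 1" "absval y \<le> 1"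
  shows "series_at C x y \<in> OD_level p n"
proof -
  have null: "null_family (\<lambda>\<nu>. C \<nu> s)" for s using assms(1) unfolding analytic_coeffs_def by blast
  have "0 \<le> s \<and> s * of_nat p ^ n \<in> \<int>" if "series_at C x y s \<noteq> 0" for s
  proof (rule ccontr)
    assume "\<not> ?thesis"
    then have "C \<nu> s = 0" for \<nu> using assms(1) unfolding analytic_coeffs_def by blast
    then have "absval (series_at C x y s) \<le> 0"
      unfolding series_at_def using assms by (intro absval_series_le complete null) auto
    then show False using that by simp
  qed
  moreover have "gauss_bounded r (series_at C x y)" if r: "0 < r \<and> r < 1" for r
  proof -
    obtain M where M: "\<And>\<nu> s. absval (C \<nu> s) * r powr real_of_rat s \<le> M"
      using assms(1) r unfolding analytic_coeffs_def by blast
    have "absval (series_at C x y s) \<le> M / r powr real_of_rat s" for s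
      unfolding series_at_def using assms M r order_trans[OF _ M[of undefined s]]
      by (intro absval_series_le complete null) (auto simp: pos_le_divide_eq)
    then show ?thesis using r unfolding gauss_bounded_def by (auto simp: pos_le_divide_eq)
  qed
  ultimately show ?thesis unfolding OD_level_def by blast
qed

lemma OD_level_diff_cmult:
  assumes "a \<in> OD_level p n" "b \<in> OD_level p n"
  shows "(\<lambda>s. k * a s - k' * b s) \<in> OD_level p n"
proof -
  have "0 \<le> s \<and> s * of_nat p ^ n \<in> \<int>" if "k * a s - k' * b s \<noteq> 0" for s
    using that assms unfolding OD_level_def by (cases "a s = 0") auto
  then show ?thesis
    using assms unfolding OD_level_def by (auto intro!: gauss_bounded_diff gauss_bounded_cmult)
qed

definition coeffs_dx :: "(nat \<times> nat \<Rightarrow> rat \<Rightarrow> 'c) \<Rightarrow> nat \<times> nat \<Rightarrow> rat \<Rightarrow> 'c" where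
  "coeffs_dx C = (\<lambda>\<nu> s. dx_coeffs (\<lambda>\<nu>. C \<nu> s) \<nu>)"

definition coeffs_dy :: "(nat \<times> nat \<Rightarrow> rat \<Rightarrow> 'c) \<Rightarrow> nat \<times> nat \<Rightarrow> rat \<Rightarrow> 'c" where
  "coeffs_dy C = (\<lambda>\<nu> s. dy_coeffs (\<lambda>\<nu>. C \<nu> s) \<nu>)"

lemma analytic_coeffs_zero_off: "analytic_coeffs n C \<Longrightarrow> s * of_nat p ^ n \<notin> \<int> \<Longrightarrow> C \<nu> s = 0"
  unfolding analytic_coeffs_def by blast

lemma analytic_coeffs_dx: 
  assumes "analytic_coeffs n C"
  shows "analytic_coeffs n (coeffs_dx C)"
  by (rule analytic_coeffs_dominated[OF assms, where K = 1 and h = "\<lambda>(i,l). (Suc i, l)"])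
    (auto simp: coeffs_dx_def dx_coeffs_def inj_on_def absval_mult analytic_coeffs_zero_off[OF assms]
      intro!: mult_left_le_one_le absval_of_nat_le_1 simp del: of_nat_Suc)

lemma analytic_coeffs_dy: 
  assumes "analytic_coeffs n C"
  shows "analytic_coeffs n (coeffs_dy C)"
  by (rule analytic_coeffs_dominated[OF assms, where K = 1 and h = "\<lambda>(i,l). (i, Suc l)"])
    (auto simp: coeffs_dy_def dy_coeffs_def inj_on_def absval_mult analytic_coeffs_zero_off[OF assms]
      intro!: mult_left_le_one_le absval_of_nat_le_1 simp del: of_nat_Suc)

lemma analytic_coeffs_cmult: 
  assumes "analytic_coeffs n C"
  shows "analytic_coeffs n (\<lambda>\<nu> s. k * C \<nu> s)"
  by (rule analytic_coeffs_dominated[OF assms, where K = "absval k" and h = "\<lambda>\<nu>. \<nu>"])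
    (auto simp: absval_mult analytic_coeffs_zero_off[OF assms])

text \<open>The factor \<open>s\<close> has denominator at most \<open>p^n\<close>, hence absolute value at most \<open>p^n\<close>.\<close>
lemma analytic_coeffs_q_ddq: 
  assumes "analytic_coeffs n C"
  shows "analytic_coeffs n (\<lambda>\<nu> s. of_rat s * C \<nu> s)"
proof (rule analytic_coeffs_dominated[OF assms, where K = "real p ^ n" and h = "\<lambda>\<nu>. \<nu>"])
  fix \<nu> :: "nat \<times> nat" and s :: rat assume "s * of_nat p ^ n \<in> \<int>"
  then obtain z where z: "s * of_nat p ^ n = of_int z" by (rule Ints_cases)
  have "of_rat s * of_nat p ^ n = (of_int z :: 'c)"
    using arg_cong[OF z, of "of_rat :: rat \<Rightarrow> 'c"] by (simp add: of_rat_mult of_rat_power)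
  then have "absval (of_rat s * of_nat p ^ n :: 'c) \<le> 1" by (simp only: absval_of_int_le_1)
  then have "absval (of_rat s :: 'c) \<le> real p ^ n"
    using p_pos by (simp add: absval_mult absval_power normalised field_simps)
  then show "absval (of_rat s * C \<nu> s) \<le> real p ^ n * absval (C \<nu> s)"
    by (simp add: absval_mult mult_right_mono)
qed (auto simp: analytic_coeffs_zero_off[OF assms])

text \<open>The remainder estimate for the coefficients of all \<open>q^s\<close> at once bounds every Gauss norm
  of the remainder, which gives convergence of the difference quotients in the Frechet topology.\<close>

lemma deriv_0_series_at:
  assumes C: "analytic_coeffs n C"
    and le: "absval x \<le> 1" "absval u \<le> 1" "absval y \<le> 1" "absval v \<le> 1"
    and \<psi>: "\<And>t. t \<in> Zp \<Longrightarrow> absval t \<le> 1 / real p ^ n \<Longrightarrow>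
      \<psi> t = series_at C (x + t / of_nat p ^ n * u) (y + t / of_nat p ^ n * v)"
  shows "deriv_0 p \<psi> = (\<lambda>s. (u * series_at (coeffs_dx C) x y s + v * series_at (coeffs_dy C) x y s) / of_nat p ^ n)"
    (is "_ = ?l")
proof (rule deriv_0_eqI[OF prime normalised])
  define P where "P = (of_nat p ^ n :: 'c)"
  have P: "P \<noteq> 0" "absval P = 1 / real p ^ n"
    using p_pos by (simp_all add: P_def absval_power normalised power_one_over)
  have null: "null_family (\<lambda>\<nu>. C \<nu> s)" for s using C unfolding analytic_coeffs_def by blast
  have "(\<lambda>s. u / P * series_at (coeffs_dx C) x y s - (- v / P) * series_at (coeffs_dy C) x y s) \<in> OD_level p n"
    by (intro OD_level_diff_cmult series_at_in_OD_level analytic_coeffs_dx analytic_coeffs_dy C le)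
  then have l: "?l \<in> OD_level p n" by (simp add: P_def add_divide_distrib)
  have \<tau>: "absval (t / P) \<le> 1" if "absval t \<le> 1 / real p ^ n" for t
    using that p_pos by (simp add: absval_divide P field_simps)
  show "limitin (OD_topology p) (\<lambda>t s. (\<psi> t s - \<psi> 0 s) / t) ?l (at 0 within Zp)"
    unfolding limitin_OD_iff
  proof (intro conjI allI impI)
    show "?l \<in> OD p" using l OD_level_subset_OD[OF p_pos(2)] by blast
  next
    fix r \<epsilon> :: real assume r: "0 < r \<and> r < 1 \<and> 0 < \<epsilon>"
    obtain M where M: "\<And>\<nu> s. absval (C \<nu> s) * r powr real_of_rat s \<le> M"
      using C r unfolding analytic_coeffs_def by blast
    have M0: "M \<ge> 0" by (rule order_trans[OF _ M[of undefined 0]]) simp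
    \<comment> \<open>Below, the Gauss norm of the error at \<open>t\<close> is bounded by \<open>absval t * (p^n)\<^sup>2 * M\<close>: the increment
        \<open>\<tau> = t / p^n\<close> enters squared, and the quotient is divided by \<open>t\<close>.\<close>
    define d where "d = min (1 / real p ^ n) (\<epsilon> / ((real p ^ n)\<^sup>2 * (M + 1)))"
    have d: "d > 0" unfolding d_def using p_pos M0 r by simp
    have main: "(\<lambda>s. (\<psi> t s - \<psi> 0 s) / t) \<in> OD p \<and>
        gauss_norm r (\<lambda>s. (\<psi> t s - \<psi> 0 s) / t - ?l s) < \<epsilon>"
      if t: "t \<in> Zp" "t \<noteq> 0" "dist t 0 < d" for t
    proof
      have t1: "absval t \<le> 1 / real p ^ n" "absval t < \<epsilon> / ((real p ^ n)\<^sup>2 * (M + 1))"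
        using t(3) unfolding d_def absval_eq_dist by auto
      have \<psi>t: "\<psi> t = series_at C (x + t / P * u) (y + t / P * v)" "\<psi> 0 = series_at C x y"
        using \<psi>[OF t(1) t1(1)] \<psi>[of 0] by (simp_all add: P_def)
      have "series_at C (x + t / P * u) (y + t / P * v) \<in> OD_level p n"
        by (intro series_at_in_OD_level C absval_add_le absval_mult_le_1 le \<tau> t1)
      moreover have "series_at C x y \<in> OD_level p n"
        by (intro series_at_in_OD_level C le)
      ultimately have "(\<lambda>s. 1 / t * \<psi> t s - 1 / t * \<psi> 0 s) \<in> OD_level p n"
        unfolding \<psi>t by (rule OD_level_diff_cmult)
      then show "(\<lambda>s. (\<psi> t s - \<psi> 0 s) / t) \<in> OD p"
        using OD_level_subset_OD[OF p_pos(2)] by (auto simp: diff_divide_distrib)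
      have "absval ((\<psi> t s - \<psi> 0 s) / t - ?l s) * r powr real_of_rat s \<le> absval t * (real p ^ n)\<^sup>2 * M" for s
      proof -
        define D where "D = u * series_at (coeffs_dx C) x y s + v * series_at (coeffs_dy C) x y s"
        define R where "R = \<psi> t s - \<psi> 0 s - t / P * D"
        have "absval R \<le> absval (t / P) ^ 2 * (M / r powr real_of_rat s)"
          unfolding R_def D_def \<psi>t series_at_def coeffs_dx_def coeffs_dy_def
          using M M0 r by (intro series_first_order complete null le \<tau> t1) (auto simp: pos_le_divide_eq)
        then have R: "absval R * r powr real_of_rat s \<le> absval (t / P) ^ 2 * M"
          using r by (simp add: pos_le_divide_eq)
        have "(\<psi> t s - \<psi> 0 s) / t - ?l s = R / t"
          using t(2) P(1) unfolding R_def D_def P_def[symmetric] by (simp add: field_simps)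
        then have "absval ((\<psi> t s - \<psi> 0 s) / t - ?l s) * r powr real_of_rat s
            = absval R * r powr real_of_rat s / absval t"
          by (simp add: absval_divide)
        also have "\<dots> \<le> absval (t / P) ^ 2 * M / absval t"
          using R by (intro divide_right_mono) auto
        also have "\<dots> = absval t * (real p ^ n)\<^sup>2 * M"
          using t(2) by (simp add: absval_divide P power2_eq_square)
        finally show ?thesis .
      qed
      then have "gauss_norm r (\<lambda>s. (\<psi> t s - \<psi> 0 s) / t - ?l s) \<le> absval t * (real p ^ n)\<^sup>2 * M"
        by (rule gauss_norm_least)
      also have "\<dots> \<le> absval t * ((real p ^ n)\<^sup>2 * (M + 1))"
        using M0 by (simp add: mult.assoc mult_left_mono)
      also have "\<dots> < \<epsilon>"
        using t1(2) M0 p_pos by (simp add: pos_less_divide_eq)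
      finally show "gauss_norm r (\<lambda>s. (\<psi> t s - \<psi> 0 s) / t - ?l s) < \<epsilon>" .
    qed
    show "\<forall>\<^sub>F t in at 0 within Zp. (\<lambda>s. (\<psi> t s - \<psi> 0 s) / t) \<in> OD p \<and>
        gauss_norm r (\<lambda>s. (\<psi> t s - \<psi> 0 s) / t - ?l s) < \<epsilon>"
      unfolding eventually_at using main d by blast
  qed
qed

text \<open>The coordinates \<open>(x, y)\<close> on the part of the coset \<open>g \<Gamma>(p^n)\<close> where the first column is that of \<open>g\<close>.
  The derivatives in question stay inside it.\<close>
definition shear :: "nat \<Rightarrow> 'c^2^2 \<Rightarrow> 'c \<Rightarrow> 'c \<Rightarrow> 'c^2^2" where
  "shear n g x y = g ** (mat 1 + scale_mat (of_nat p ^ n) (mat2 0 x 0 y))"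

lemma shear_nth:
  "shear n g x y $ i $ 1 = g$i$1"
  "shear n g x y $ i $ 2 = g$i$2 + of_nat p ^ n * (g$i$1 * x + g$i$2 * y)"
  by (simp_all add: shear_def matrix_mult_2_nth algebra_simps)

lemma shear_0_0: "shear n g 0 0 = g"
  by (simp add: mat2_eq_iff shear_nth)

definition expands :: "nat \<Rightarrow> (nat \<times> nat \<Rightarrow> rat \<Rightarrow> 'c) \<Rightarrow> 'c sect \<Rightarrow> 'c^2^2 \<Rightarrow> bool" where
  "expands n C f g \<longleftrightarrow> analytic_coeffs n C \<and> (\<forall>x\<in>Zp. \<forall>y\<in>Zp. f (shear n g x y) = series_at C x y)"

text \<open>The operator \<open>p\<^sup>-\<^sup>n \<partial>\<^sub>x\<close>, by which both \<open>u\<^sup>+\<close> and \<open>a \<partial>\<^sub>b + c \<partial>\<^sub>d\<close> act on power series.\<close>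
definition coeffs_u_plus :: "nat \<Rightarrow> (nat \<times> nat \<Rightarrow> rat \<Rightarrow> 'c) \<Rightarrow> nat \<times> nat \<Rightarrow> rat \<Rightarrow> 'c" where
  "coeffs_u_plus n C = (\<lambda>\<nu> s. 1 / of_nat p ^ n * coeffs_dx C \<nu> s)"

definition coeffs_q_ddq :: "(nat \<times> nat \<Rightarrow> rat \<Rightarrow> 'c) \<Rightarrow> nat \<times> nat \<Rightarrow> rat \<Rightarrow> 'c" where
  "coeffs_q_ddq C = (\<lambda>\<nu> s. of_rat s * C \<nu> s)"

lemma series_at_cmult:
  assumes "analytic_coeffs n C" "x \<in> Zp" "y \<in> Zp"
  shows "series (\<lambda>\<nu>. k * C \<nu> s) x y = k * series_at C x y s"
  unfolding series_at_def
  using assms(1) by (intro series_cmult complete absval_Zp assms(2,3)) (simp add: analytic_coeffs_def)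

lemma Zp_shift:
  assumes "t \<in> (Zp :: 'c set)" "absval t \<le> 1 / real p ^ n" "x \<in> Zp" "u \<in> Zp"
  shows "x + t / of_nat p ^ n * u \<in> Zp"
  by (intro Zp_add Zp_mult Zp_divide_power[OF prime normalised] assms)

lemma expands_q_ddq:
  assumes "expands n C f g"
  shows "expands n (coeffs_q_ddq C) (q_ddq f) g"
proof -
  have C: "analytic_coeffs n C" using assms unfolding expands_def by blast
  have "series_at (coeffs_q_ddq C) x y = (\<lambda>s. of_rat s * series_at C x y s)" if "x \<in> Zp" "y \<in> Zp" for x y
    using series_at_cmult[OF C that] by (subst series_at_def) (simp add: coeffs_q_ddq_def)
  then show ?thesis
    using assms analytic_coeffs_q_ddq[OF C]
    unfolding expands_def by (simp add: q_ddq_def coeffs_q_ddq_def)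
qed

lemma series_at_u_plus:
  assumes "analytic_coeffs n C" "x \<in> Zp" "y \<in> Zp"
  shows "series_at (coeffs_u_plus n C) x y = (\<lambda>s. series_at (coeffs_dx C) x y s / of_nat p ^ n)"
  using series_at_cmult[OF analytic_coeffs_dx[OF assms(1)] assms(2,3), of "1 / of_nat p ^ n"]
  by (subst series_at_def) (simp add: coeffs_u_plus_def)

text \<open>Right multiplication by \<open>1 + t u\<^sup>+\<close> adds \<open>t\<close> times the first column of \<open>g\<close> to the second, that
  is, it adds \<open>t / p^n\<close> to the coordinate \<open>x\<close>.\<close>
lemma expands_gl2_act:
  assumes "expands n C f g"
  shows "expands n (coeffs_u_plus n C) (gl2_act p (mat2 0 1 0 0) f) g"
  unfolding expands_def
proof (intro conjI ballI)
  have C: "analytic_coeffs n C" using assms unfolding expands_def by blast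
  then show "analytic_coeffs n (coeffs_u_plus n C)"
    unfolding coeffs_u_plus_def by (intro analytic_coeffs_cmult analytic_coeffs_dx)
  have f_eq: "f (shear n g x y) = series_at C x y" if "x \<in> Zp" "y \<in> Zp" for x y
    using assms(1) that unfolding expands_def by blast
  fix x y :: 'c assume xy: "x \<in> Zp" "y \<in> Zp"
  have shift: "shear n g x y ** mat2 1 t 0 1 =
      shear n g (x + t / of_nat p ^ n * 1) (y + t / of_nat p ^ n * 0)" for t
    using p_pos by (simp add: mat2_eq_iff matrix_mult_2_nth shear_nth field_simps)
  have "gl2_act p (mat2 0 1 0 0) f (shear n g x y)
      = (\<lambda>s. (1 * series_at (coeffs_dx C) x y s + 0 * series_at (coeffs_dy C) x y s) / of_nat p ^ n)"
    unfolding gl2_act_def mat_exp_unipotent shift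
  proof (rule deriv_0_series_at[OF C])
    fix t :: 'c assume "t \<in> Zp" "absval t \<le> 1 / real p ^ n"
    then show "f (shear n g (x + t / of_nat p ^ n * 1) (y + t / of_nat p ^ n * 0)) =
        series_at C (x + t / of_nat p ^ n * 1) (y + t / of_nat p ^ n * 0)"
      using xy by (intro f_eq Zp_shift) auto
  qed (use xy absval_Zp in auto)
  then show "gl2_act p (mat2 0 1 0 0) f (shear n g x y) = series_at (coeffs_u_plus n C) x y"
    by (simp add: series_at_u_plus[OF C xy])
qed

text \<open>Adding \<open>t\<close> to an entry of the second column moves \<open>(x, y)\<close> in the direction of the
  corresponding column of the inverse matrix, which is integral.\<close>
lemma partial_deriv_expands:
  assumes "expands n C f g" and inv: "g ** g' = mat 1" "g' \<in> M2 Zp" and xy: "x \<in> Zp" "y \<in> Zp"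
  shows "partial_deriv p i 2 f (shear n g x y) =
    (\<lambda>s. (g'$1$i * series_at (coeffs_dx C) x y s + g'$2$i * series_at (coeffs_dy C) x y s) / of_nat p ^ n)"
proof -
  have C: "analytic_coeffs n C" using assms unfolding expands_def by blast
  have f_eq: "f (shear n g x y) = series_at C x y" if "x \<in> Zp" "y \<in> Zp" for x y
    using assms(1) that unfolding expands_def by blast
  have g': "g'$1$i \<in> Zp" "g'$2$i \<in> Zp" using inv(2) unfolding M2_def by auto
  have gg': "g$k$1 * g'$1$i + g$k$2 * g'$2$i = (if k = i then 1 else 0)" for k
    using arg_cong[OF inv(1), of "\<lambda>X. X$k$i"] by (simp add: matrix_mult_2_nth mat_def)
  have shift: "shear n g x y + (\<chi> i' j'. if i' = i \<and> j' = 2 then t else 0) =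
      shear n g (x + t / of_nat p ^ n * g'$1$i) (y + t / of_nat p ^ n * g'$2$i)" (is "?L t = ?R t") for t
  proof -
    have "?R t $ k $ 2 = shear n g x y $ k $ 2 + t * (g$k$1 * g'$1$i + g$k$2 * g'$2$i)" for k
      using p_pos by (simp add: shear_nth field_simps)
    then have "?R t $ k $ 2 = shear n g x y $ k $ 2 + (if k = i then t else 0)" for k
      unfolding gg' by simp
    then have "?L t $ k $ 2 = ?R t $ k $ 2" for k by simp
    moreover have "?L t $ k $ 1 = ?R t $ k $ 1" for k by (simp add: shear_nth)
    ultimately show ?thesis unfolding mat2_eq_iff by blast
  qed
  show ?thesis
    unfolding partial_deriv_def shift
  proof (rule deriv_0_series_at[OF C])
    fix t :: 'c assume "t \<in> Zp" "absval t \<le> 1 / real p ^ n"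
    then show "f (shear n g (x + t / of_nat p ^ n * g'$1$i) (y + t / of_nat p ^ n * g'$2$i)) =
        series_at C (x + t / of_nat p ^ n * g'$1$i) (y + t / of_nat p ^ n * g'$2$i)"
      using xy g' by (intro f_eq Zp_shift)
  qed (use xy g' absval_Zp in auto)
qed

text \<open>The weights \<open>a\<close> and \<open>c\<close> form the first column of \<open>g\<close>, so the directions of \<open>\<partial>\<^sub>b\<close> and \<open>\<partial>\<^sub>d\<close>, the columns of
  the inverse, combine to the first unit vector.\<close>
lemma expands_a_b_plus_c_d:
  assumes "expands n C f g" and inv: "g ** g' = mat 1" "g' ** g = mat 1" "g' \<in> M2 Zp"
  shows "expands n (coeffs_u_plus n C) (a_b_plus_c_d p f) g"
  unfolding expands_def
proof (intro conjI ballI)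
  have C: "analytic_coeffs n C" using assms unfolding expands_def by blast
  then show "analytic_coeffs n (coeffs_u_plus n C)"
    unfolding coeffs_u_plus_def by (intro analytic_coeffs_cmult analytic_coeffs_dx)
  fix x y :: 'c assume xy: "x \<in> Zp" "y \<in> Zp"
  have g'g: "g'$1$1 * g$1$1 + g'$1$2 * g$2$1 = 1" "g'$2$1 * g$1$1 + g'$2$2 * g$2$1 = 0"
    using arg_cong[OF inv(2), of "\<lambda>X. X$1$1"] arg_cong[OF inv(2), of "\<lambda>X. X$2$1"]
    by (simp_all add: matrix_mult_2_nth)
  have "a_b_plus_c_d p f (shear n g x y) = (\<lambda>s.
      ((g'$1$1 * g$1$1 + g'$1$2 * g$2$1) * series_at (coeffs_dx C) x y s
       + (g'$2$1 * g$1$1 + g'$2$2 * g$2$1) * series_at (coeffs_dy C) x y s) / of_nat p ^ n)"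
    unfolding a_b_plus_c_d_def partial_deriv_expands[OF assms(1) inv(1,3) xy] shear_nth
    by (simp add: algebra_simps add_divide_distrib)
  then show "a_b_plus_c_d p f (shear n g x y) = series_at (coeffs_u_plus n C) x y"
    unfolding g'g by (simp add: series_at_u_plus[OF C xy])
qed

lemma coeffs_q_ddq_u_plus: "coeffs_q_ddq (coeffs_u_plus n C) = coeffs_u_plus n (coeffs_q_ddq C)"
  by (auto simp: fun_eq_iff coeffs_q_ddq_def coeffs_u_plus_def coeffs_dx_def dx_coeffs_def)

text \<open>Both sides have the same power series around \<open>g\<close>; its constant term is the value at \<open>g\<close>.\<close>
lemma q_ddq_gl2_act_eq_a_b_plus_c_d_q_ddq:
  assumes "expands n C f g" and "g \<in> GL2_Zp"
  shows "(q_ddq ^^ k) ((gl2_act p (mat2 0 1 0 0) ^^ k) f) g = (a_b_plus_c_d p ^^ k) ((q_ddq ^^ k) f) g"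
proof -
  obtain g' where g': "g' \<in> M2 Zp" "g ** g' = mat 1" "g' ** g = mat 1"
    using assms(2) unfolding GL2_Zp_def by blast
  have act: "expands n ((coeffs_u_plus n ^^ j) D) ((gl2_act p (mat2 0 1 0 0) ^^ j) h) g"
    if "expands n D h g" for D h j
    using that by (induction j) (auto intro: expands_gl2_act)
  have raise: "expands n ((coeffs_u_plus n ^^ j) D) ((a_b_plus_c_d p ^^ j) h) g"
    if "expands n D h g" for D h j
    using that by (induction j) (auto intro: expands_a_b_plus_c_d g')
  have q: "expands n ((coeffs_q_ddq ^^ j) D) ((q_ddq ^^ j) h) g" if "expands n D h g" for D h j
    using that by (induction j) (auto intro: expands_q_ddq)
  have comm1: "coeffs_q_ddq ((coeffs_u_plus n ^^ j) D) = (coeffs_u_plus n ^^ j) (coeffs_q_ddq D)" for j D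
    by (induction j) (auto simp: coeffs_q_ddq_u_plus)
  have comm: "(coeffs_q_ddq ^^ i) ((coeffs_u_plus n ^^ j) D) = (coeffs_u_plus n ^^ j) ((coeffs_q_ddq ^^ i) D)" for i j D
    by (induction i) (auto simp: comm1)
  have val: "h g = series_at D 0 0" if "expands n D h g" for D h
    using that shear_0_0[of n g] unfolding expands_def by (metis zero_in_Zp)
  show ?thesis
    using val[OF q[OF act[OF assms(1)]]] val[OF raise[OF q[OF assms(1)]]] by (simp add: comm)
qed

end

section \<open>The identity theorem for graded p-adic power series\<close>

text \<open>A family over an arbitrary index set is treated as a power series in one variable by collecting
  the terms of equal degree. In the application the indices are exponents of monomials in four
  variables that are restricted to a line.\<close>
lemma graded_partial_sum_le:
  fixes d :: "'i \<Rightarrow> 'c::ultrametric_field"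
  assumes "\<And>m. finite {\<nu>. deg \<nu> \<le> m}"
    and "((\<lambda>\<nu>. d \<nu> * x ^ deg \<nu>) has_sum S) UNIV"
    and "0 \<le> K" and "\<And>\<nu>. deg \<nu> > m \<Longrightarrow> absval (d \<nu> * x ^ deg \<nu>) \<le> K"
  shows "absval (S - (\<Sum>j\<le>m. (\<Sum>\<nu> | deg \<nu> = j. d \<nu>) * x ^ j)) \<le> K"
proof -
  let ?T = "{\<nu>. deg \<nu> \<le> m}"
  have "(\<Sum>j\<le>m. \<Sum>\<nu> | \<nu> \<in> ?T \<and> deg \<nu> = j. d \<nu> * x ^ deg \<nu>) = (\<Sum>\<nu>\<in>?T. d \<nu> * x ^ deg \<nu>)"
    by (rule sum.group) (auto simp: assms(1))
  moreover have "(\<Sum>\<nu> | \<nu> \<in> ?T \<and> deg \<nu> = j. d \<nu> * x ^ deg \<nu>) = (\<Sum>\<nu> | deg \<nu> = j. d \<nu>) * x ^ j"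
    if "j \<le> m" for j
    unfolding sum_distrib_right using that by (intro sum.cong) auto
  ultimately have eq: "(\<Sum>j\<le>m. (\<Sum>\<nu> | deg \<nu> = j. d \<nu>) * x ^ j) = (\<Sum>\<nu>\<in>?T. d \<nu> * x ^ deg \<nu>)"
    by simp
  have "((\<lambda>\<nu>. d \<nu> * x ^ deg \<nu>) has_sum (\<Sum>\<nu>\<in>?T. d \<nu> * x ^ deg \<nu>)) ?T"
    by (rule has_sum_finite) (rule assms(1))
  then have "((\<lambda>\<nu>. if deg \<nu> \<le> m then d \<nu> * x ^ deg \<nu> else 0) has_sum (\<Sum>\<nu>\<in>?T. d \<nu> * x ^ deg \<nu>)) UNIV"
    by (rule has_sum_cong_neutral[THEN iffD1, rotated -1]) auto
  from has_sum_diff_ultrametric[OF assms(2) this] assms(3)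
  show ?thesis unfolding eq
    by (rule has_sum_absval_le) (use assms(3,4) in \<open>auto simp: not_le\<close>)
qed

text \<open>A power series that takes its constant term as value along a sequence tending to \<open>0\<close>
  is constant: the first nonvanishing coefficient of positive degree would dominate.\<close>

lemma graded_series_constant:
  fixes d :: "'i \<Rightarrow> 'c::ultrametric_field"
  assumes null: "null_family d" and fin: "\<And>m. finite {\<nu>. deg \<nu> \<le> m}"
    and sums: "\<And>x. x \<in> Zp \<Longrightarrow> ((\<lambda>\<nu>. d \<nu> * x ^ deg \<nu>) has_sum \<phi> x) UNIV"
    and \<xi>: "\<xi> \<longlonglongrightarrow> 0" "\<And>M. \<xi> M \<noteq> 0" "\<And>M. \<xi> M \<in> Zp" "\<And>M. \<phi> (\<xi> M) = \<phi> 0"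
    and x: "x \<in> Zp"
  shows "\<phi> x = \<phi> 0"
proof -
  define c where "c = (\<lambda>j. \<Sum>\<nu> | deg \<nu> = j. d \<nu>)"
  have "finite {\<nu>. absval (d \<nu>) \<ge> 1}" using null unfolding null_family_def by simp
  then have "finite (insert 1 ((\<lambda>\<nu>. absval (d \<nu>)) ` {\<nu>. absval (d \<nu>) \<ge> 1}))" by simp
  define B where "B = Max (insert 1 ((\<lambda>\<nu>. absval (d \<nu>)) ` {\<nu>. absval (d \<nu>) \<ge> 1}))"
  have B: "absval (d \<nu>) \<le> B" "1 \<le> B" for \<nu>
  proof -
    show "1 \<le> B" unfolding B_def by (rule Max_ge) (use \<open>finite (insert 1 _)\<close> in auto)
    then show "absval (d \<nu>) \<le> B"
    proof (cases "absval (d \<nu>) \<ge> 1")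
      case True
      then show ?thesis unfolding B_def by (intro Max_ge) (use \<open>finite (insert 1 _)\<close> in auto)
    qed simp
  qed
  have tail: "absval (\<phi> y - (\<Sum>j\<le>m. c j * y ^ j)) \<le> B * absval y ^ Suc m" if y: "y \<in> Zp" for y m
    unfolding c_def
  proof (rule graded_partial_sum_le[OF fin sums[OF y]])
    fix \<nu> assume "deg \<nu> > m"
    then have "absval y ^ deg \<nu> \<le> absval y ^ Suc m"
      by (intro power_decreasing) (auto simp: absval_Zp y)
    then show "absval (d \<nu> * y ^ deg \<nu>) \<le> B * absval y ^ Suc m"
      unfolding absval_mult absval_power using B by (intro mult_mono) auto
  qed (use B in auto)
  have c0: "\<phi> 0 = c 0" using tail[of 0 0] by simp
  have c: "c i = 0" if "i \<ge> 1" for i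
    using that
  proof (induction i rule: less_induct)
    case (less i)
    have "(\<Sum>j\<le>i. c j * y ^ j) = c 0 + c i * y ^ i" for y
    proof -
      have "(\<Sum>j\<le>i. c j * y ^ j) = (\<Sum>j\<in>{0,i}. c j * y ^ j)"
        using less by (intro sum.mono_neutral_right) auto
      then show ?thesis using less.prems by simp
    qed
    then have "absval (\<phi> (\<xi> M) - (c 0 + c i * \<xi> M ^ i)) \<le> B * absval (\<xi> M) ^ Suc i" for M
      using tail[OF \<xi>(3), of M i] by simp
    then have "absval (c i) * absval (\<xi> M) ^ i \<le> B * absval (\<xi> M) * absval (\<xi> M) ^ i" for M
      by (simp add: \<xi>(4) c0 absval_mult absval_power mult.assoc)
    then have le: "absval (c i) \<le> B * absval (\<xi> M)" for M
      using \<xi>(2)[of M] by (simp add: mult_le_cancel_right)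
    have "absval (c i) \<le> \<epsilon>" if "\<epsilon> > 0" for \<epsilon>
    proof -
      have "\<epsilon> / B > 0" using that B(2) by simp
      then have "\<forall>\<^sub>F M in sequentially. absval (\<xi> M) < \<epsilon> / B"
        using \<xi>(1) unfolding tendsto_iff_absval by simp
      then obtain M where "absval (\<xi> M) < \<epsilon> / B" by (meson eventually_happens' sequentially_bot)
      then have "B * absval (\<xi> M) \<le> \<epsilon>" using B(2) by (simp add: pos_less_divide_eq mult.commute)
      then show ?thesis using le[of M] by linarith
    qed
    then have "absval (c i) \<le> 0" by (meson dense_ge not_le)
    then show ?case by simp
  qed
  have "absval (\<phi> x - \<phi> 0) \<le> \<epsilon>" if \<epsilon>: "\<epsilon> > 0" for \<epsilon>
  proof -
    have "finite (insert 0 (deg ` {\<nu>. absval (d \<nu>) \<ge> \<epsilon>}))"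
      using null \<epsilon> unfolding null_family_def by simp
    define m where "m = Max (insert 0 (deg ` {\<nu>. absval (d \<nu>) \<ge> \<epsilon>}))"
    have m: "absval (d \<nu>) \<le> \<epsilon>" if "deg \<nu> > m" for \<nu>
    proof (rule ccontr)
      assume "\<not> ?thesis"
      then have "deg \<nu> \<le> m" unfolding m_def
        by (intro Max_ge) (use \<open>finite (insert 0 _)\<close> in auto)
      then show False using that by simp
    qed
    have "absval (\<phi> x - (\<Sum>j\<le>m. c j * x ^ j)) \<le> \<epsilon>"
      unfolding c_def
    proof (rule graded_partial_sum_le[OF fin sums[OF x]])
      fix \<nu> assume "deg \<nu> > m"
      have "absval (d \<nu>) * absval (x ^ deg \<nu>) \<le> absval (d \<nu>)"
        by (intro mult_left_le absval_power_le_1 absval_Zp x) auto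
      then show "absval (d \<nu> * x ^ deg \<nu>) \<le> \<epsilon>"
        using m[OF \<open>deg \<nu> > m\<close>] unfolding absval_mult by linarith
    qed (use \<epsilon> in auto)
    moreover have "(\<Sum>j\<le>m. c j * x ^ j) = (\<Sum>j\<in>{0}. c j * x ^ j)"
      using c by (intro sum.mono_neutral_right) auto
    ultimately show ?thesis by (simp add: c0)
  qed
  then have "absval (\<phi> x - \<phi> 0) \<le> 0" by (meson dense_ge not_le)
  then show ?thesis by simp
qed

section \<open>Locally analytic sections have bounded level\<close>

text \<open>The reduction of the exponent modulo \<open>p^N\<close> is invisible to a root of unity of that order.\<close>
lemma root_power_of_nat:
  fixes \<zeta> :: "nat \<Rightarrow> 'c::ultrametric_field"
  assumes "prime p" "absval (of_nat p :: 'c) = 1 / real p" "compatible_roots p \<zeta>"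
  shows "root_power p \<zeta> N (of_nat k) = \<zeta> N ^ k"
proof -
  have p: "p > 0" using prime_gt_0_nat[OF assms(1)] .
  have "(THE m. m < p ^ N \<and> absval (of_nat k - of_nat m :: 'c) \<le> 1 / real p ^ N) = k mod p ^ N"
  proof (rule the_equality)
    have "of_nat k - of_nat (k mod p ^ N) = (of_nat (p ^ N * (k div p ^ N)) :: 'c)"
      by (simp flip: of_nat_diff add: minus_mod_eq_mult_div)
    then have "absval (of_nat k - of_nat (k mod p ^ N) :: 'c) = 1 / real p ^ N * absval (of_nat (k div p ^ N) :: 'c)"
      by (simp add: absval_mult absval_power assms(2) power_one_over)
    also have "\<dots> \<le> 1 / real p ^ N"
      by (intro mult_left_le absval_of_nat_le_1) auto
    finally show "k mod p ^ N < p ^ N \<and> absval (of_nat k - of_nat (k mod p ^ N) :: 'c) \<le> 1 / real p ^ N"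
      using p by simp
  next
    fix m assume m: "m < p ^ N \<and> absval (of_nat k - of_nat m :: 'c) \<le> 1 / real p ^ N"
    then have "absval (of_int (int k - int m) :: 'c) \<le> 1 / real p ^ N" by simp
    then have "int p ^ N dvd int k - int m" by (rule power_dvd_if_absval_le[OF assms(1,2)])
    then have "int k mod int (p ^ N) = int m mod int (p ^ N)" by (simp add: mod_eq_dvd_iff)
    then have "k mod p ^ N = m mod p ^ N" by (metis of_nat_eq_iff zmod_int)
    then show "m = k mod p ^ N" using m by simp
  qed
  then have "root_power p \<zeta> N (of_nat k) = \<zeta> N ^ (k mod p ^ N)" unfolding root_power_def by simp
  also have "\<dots> = (\<zeta> N ^ p ^ N) ^ (k div p ^ N) * \<zeta> N ^ (k mod p ^ N)"
    using assms(3) unfolding compatible_roots_def by simp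
  also have "\<dots> = \<zeta> N ^ k" by (simp flip: power_mult power_add)
  finally show ?thesis .
qed

lemma root_order_dvd:
  assumes "compatible_roots p \<zeta>" "p > 0" "\<zeta> N ^ k = 1"
  shows "p ^ N dvd k"
proof (rule ccontr)
  assume "\<not> p ^ N dvd k"
  then have "0 < k mod p ^ N" "k mod p ^ N < p ^ N" using assms(2) by (auto simp: dvd_eq_mod_eq_0)
  then have "\<zeta> N ^ (k mod p ^ N) \<noteq> 1" using assms(1) unfolding compatible_roots_def by blast
  moreover have "\<zeta> N ^ k = (\<zeta> N ^ p ^ N) ^ (k div p ^ N) * \<zeta> N ^ (k mod p ^ N)"
    by (simp flip: power_mult power_add)
  then have "\<zeta> N ^ k = \<zeta> N ^ (k mod p ^ N)"
    using assms(1) unfolding compatible_roots_def by simp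
  ultimately show False using assms(3) by simp
qed

lemma monomial_2: "monomial X \<nu> = X$1$1 ^ \<nu>$1$1 * X$1$2 ^ \<nu>$1$2 * (X$2$1 ^ \<nu>$2$1 * X$2$2 ^ \<nu>$2$2)"
  by (simp add: monomial_def UNIV_2)

definition total_degree :: "nat^2^2 \<Rightarrow> nat" where
  "total_degree \<nu> = \<nu>$1$1 + \<nu>$1$2 + (\<nu>$2$1 + \<nu>$2$2)"

lemma monomial_scale: "monomial (scale_mat x Y) \<nu> = x ^ total_degree \<nu> * monomial Y \<nu>"
  by (simp add: monomial_2 total_degree_def power_mult_distrib power_add ac_simps)

lemma finite_total_degree_le: "finite {\<nu>. total_degree \<nu> \<le> m}"
proof (rule finite_subset)
  show "{\<nu>. total_degree \<nu> \<le> m} \<subseteq> (\<lambda>(a,b,c,d). mat2 a b c d) ` ({..m} \<times> {..m} \<times> {..m} \<times> {..m})"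
  proof
    fix \<nu> assume "\<nu> \<in> {\<nu>. total_degree \<nu> \<le> m}"
    then have "(\<nu>$1$1, \<nu>$1$2, \<nu>$2$1, \<nu>$2$2) \<in> {..m} \<times> {..m} \<times> {..m} \<times> {..m}"
      by (simp add: total_degree_def)
    moreover have "\<nu> = (\<lambda>(a,b,c,d). mat2 a b c d) (\<nu>$1$1, \<nu>$1$2, \<nu>$2$1, \<nu>$2$2)"
      by (simp add: mat2_eq_iff)
    ultimately show "\<nu> \<in> (\<lambda>(a,b,c,d). mat2 a b c d) ` ({..m} \<times> {..m} \<times> {..m} \<times> {..m})" by blast
  qed
qed simp

lemma absval_monomial_le_1:
  assumes "X \<in> M2 Zp"
  shows "absval (monomial X \<nu>) \<le> 1"
  using assms unfolding monomial_2 M2_def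
  by (intro absval_mult_le_1 absval_power_le_1 absval_Zp) auto

lemma O_inf_in_OD:
  assumes "h \<in> O_inf p e \<zeta> U" "g \<in> GL2_preimage U"
  shows "h g \<in> OD p"
  using assms unfolding O_inf_def continuous_map_def by (auto simp: topspace_OD)

text \<open>Equivariance concerns left translation and analyticity right translation; conjugation by \<open>g\<close>
  turns one into the other.\<close>
lemma unipotent_left_mult:
  fixes g g' :: "'c::comm_ring_1^2^2"
  assumes "g ** g' = mat 1"
  shows "mat2 1 (P * x) 0 1 ** g = g ** (mat 1 + scale_mat P (scale_mat x (g' ** mat2 0 1 0 0 ** g)))"
proof -
  let ?E = "mat2 0 1 0 0 :: 'c^2^2"
  have "mat2 1 (P * x) 0 1 ** g = g + scale_mat (P * x) (?E ** g)"
    by (simp add: mat2_eq_iff matrix_mult_2_nth)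
  also have "?E ** g = g ** (g' ** ?E ** g)"
    using assms by (simp add: matrix_mul_assoc)
  also have "g + scale_mat (P * x) (g ** (g' ** ?E ** g))
      = g ** (mat 1 + scale_mat P (scale_mat x (g' ** ?E ** g)))"
    unfolding mat2_eq_iff by (simp add: matrix_mult_2_nth[of g] algebra_simps)
  finally show ?thesis .
qed

context completed_field
begin

text \<open>Convergence in a single Gauss norm already gives convergence of each coefficient.\<close>
lemma analytic_vector_has_sum:
  fixes w :: "nat^2^2 \<Rightarrow> 'c sect"
  assumes "f \<in> O_inf p e \<zeta> U" "\<And>\<nu>. w \<nu> \<in> O_inf p e \<zeta> U"
    and "g \<in> GL2_preimage U" "g ** (mat 1 + scale_mat (of_nat p ^ n) X) \<in> GL2_preimage U"
    and conv: "\<And>\<epsilon>. 0 < \<epsilon> \<Longrightarrow> \<forall>\<^sub>F F in finite_subsets_at_top UNIV. \<forall>g\<in>GL2_preimage U.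
        gauss_norm (1/2) (\<lambda>s. f (g ** (mat 1 + scale_mat (of_nat p ^ n) X)) s
                          - (\<Sum>\<nu>\<in>F. monomial X \<nu> * w \<nu> g s)) < \<epsilon>"
  shows "((\<lambda>\<nu>. monomial X \<nu> * w \<nu> g s) has_sum f (g ** (mat 1 + scale_mat (of_nat p ^ n) X)) s) UNIV"
  unfolding has_sum_def tendsto_iff_absval
proof (intro allI impI)
  fix \<epsilon> :: real assume "\<epsilon> > 0"
  then have "\<epsilon> * (1/2) powr real_of_rat s > 0" by simp
  from conv[OF this]
  show "\<forall>\<^sub>F F in finite_subsets_at_top UNIV.
      absval ((\<Sum>\<nu>\<in>F. monomial X \<nu> * w \<nu> g s) - f (g ** (mat 1 + scale_mat (of_nat p ^ n) X)) s) < \<epsilon>"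
  proof (rule eventually_mono)
    let ?g = "g ** (mat 1 + scale_mat (of_nat p ^ n) X)"
    fix F :: "(nat^2^2) set"
    assume F: "\<forall>g\<in>GL2_preimage U. gauss_norm (1/2) (\<lambda>s. f (g ** (mat 1 + scale_mat (of_nat p ^ n) X)) s
                          - (\<Sum>\<nu>\<in>F. monomial X \<nu> * w \<nu> g s)) < \<epsilon> * (1/2) powr real_of_rat s"
    have "gauss_bounded (1/2) (\<lambda>s. f ?g s - (\<Sum>\<nu>\<in>F. monomial X \<nu> * w \<nu> g s))"
      using assms(1-4)
      by (intro gauss_bounded_diff gauss_bounded_sum gauss_bounded_cmult OD_gauss_bounded O_inf_in_OD) auto
    from gauss_norm_upper[OF this, of s] bspec[OF F assms(3)]
    have "absval (f ?g s - (\<Sum>\<nu>\<in>F. monomial X \<nu> * w \<nu> g s)) * (1/2) powr real_of_rat s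
        < \<epsilon> * (1/2) powr real_of_rat s" by linarith
    then show "absval ((\<Sum>\<nu>\<in>F. monomial X \<nu> * w \<nu> g s) - f ?g s) < \<epsilon>"
      by (simp add: mult_less_cancel_right absval_minus_commute)
  qed
qed

lemma O_inf_null_family:
  fixes w :: "'i \<Rightarrow> 'c sect"
  assumes w: "\<And>\<nu>. w \<nu> \<in> O_inf p e \<zeta> U" and g: "g \<in> GL2_preimage U"
    and fin: "\<And>r \<epsilon>. 0 < r \<Longrightarrow> r < 1 \<Longrightarrow> 0 < \<epsilon> \<Longrightarrow>
      finite {\<nu>. \<exists>g\<in>GL2_preimage U. gauss_norm r (w \<nu> g) \<ge> \<epsilon>}"
  shows "null_family (\<lambda>\<nu>. w \<nu> g s)"
    and "0 < r \<Longrightarrow> r < 1 \<Longrightarrow> \<exists>M. \<forall>\<nu> s. absval (w \<nu> g s) * r powr real_of_rat s \<le> M"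
proof -
  have up: "absval (w \<nu> g s) * r powr real_of_rat s \<le> gauss_norm r (w \<nu> g)" if "0 < r" "r < 1" for \<nu> s r
    by (intro gauss_norm_upper OD_gauss_bounded[OF O_inf_in_OD[OF w g]] that)
  show "null_family (\<lambda>\<nu>. w \<nu> g s)"
    unfolding null_family_def
  proof (intro allI impI)
    fix \<epsilon> :: real assume "\<epsilon> > 0"
    then have "finite {\<nu>. \<exists>g\<in>GL2_preimage U. gauss_norm (1/2) (w \<nu> g) \<ge> \<epsilon> * (1/2) powr real_of_rat s}"
      by (intro fin) auto
    moreover have "{\<nu>. absval (w \<nu> g s) \<ge> \<epsilon>} \<subseteq>
        {\<nu>. \<exists>g\<in>GL2_preimage U. gauss_norm (1/2) (w \<nu> g) \<ge> \<epsilon> * (1/2) powr real_of_rat s}"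
    proof
      fix \<nu> assume "\<nu> \<in> {\<nu>. absval (w \<nu> g s) \<ge> \<epsilon>}"
      then have "\<epsilon> * (1/2) powr real_of_rat s \<le> absval (w \<nu> g s) * (1/2) powr real_of_rat s"
        by (intro mult_right_mono) auto
      also have "\<dots> \<le> gauss_norm (1/2) (w \<nu> g)" by (rule up) auto
      finally show "\<nu> \<in> {\<nu>. \<exists>g\<in>GL2_preimage U. gauss_norm (1/2) (w \<nu> g) \<ge> \<epsilon> * (1/2) powr real_of_rat s}"
        using g by blast
    qed
    ultimately show "finite {\<nu>. absval (w \<nu> g s) \<ge> \<epsilon>}" by (rule rev_finite_subset)
  qed
  assume r: "0 < r" "r < 1"
  define T where "T = {\<nu>. \<exists>g\<in>GL2_preimage U. gauss_norm r (w \<nu> g) \<ge> 1}"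
  have T: "finite T" unfolding T_def by (intro fin r) simp
  define M where "M = Max (insert 1 ((\<lambda>\<nu>. gauss_norm r (w \<nu> g)) ` T))"
  have "gauss_norm r (w \<nu> g) \<le> M" for \<nu>
  proof (cases "\<nu> \<in> T")
    case True
    then show ?thesis unfolding M_def using T by (intro Max_ge) auto
  next
    case False
    then have "gauss_norm r (w \<nu> g) \<le> 1" using g unfolding T_def mem_Collect_eq by (meson linear)
    also have "1 \<le> M" unfolding M_def using T by (intro Max_ge) auto
    finally show ?thesis .
  qed
  then have "absval (w \<nu> g s) * r powr real_of_rat s \<le> M" for \<nu> s
    using up[OF r] order_trans by blast
  then show "\<exists>M. \<forall>\<nu> s. absval (w \<nu> g s) * r powr real_of_rat s \<le> M" by blast
qed

text \<open>Let \<open>\<phi> x\<close> be the coefficient of \<open>q^s\<close> in \<open>f\<close> at the left translate of \<open>g\<close> by the unipotent with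
  parameter \<open>p^n x\<close>. By equivariance it is \<open>f g s\<close> up to a root of unity, which is \<open>1\<close> for \<open>x = e p^M\<close> with \<open>M\<close>
  large. As \<open>\<phi>\<close> is a power series, it is constant, so the root of unity is also \<open>1\<close> at \<open>x = e\<close>. There it
  is the \<open>p^n j\<close>-th power of \<open>\<zeta> N\<close> if \<open>s = j / p^N\<close> in lowest terms, which forces \<open>N \<le> n\<close>.\<close>
lemma analytic_vector_level:
  fixes \<zeta> :: "nat \<Rightarrow> 'c"
  assumes an: "analytic_vector p e \<zeta> n U f" and \<zeta>: "compatible_roots p \<zeta>" and e: "0 < e"
    and g: "g \<in> GL2_preimage U" and ne: "f g s \<noteq> 0"
  shows "s * of_nat p ^ n \<in> \<int>"
proof -
  obtain w where f: "f \<in> O_inf p e \<zeta> U"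
    and stable: "\<And>g X. g \<in> GL2_preimage U \<Longrightarrow> X \<in> M2 Zp \<Longrightarrow>
      g ** (mat 1 + scale_mat (of_nat p ^ n) X) \<in> GL2_preimage U"
    and w: "\<And>\<nu>. w \<nu> \<in> O_inf p e \<zeta> U"
    and fin: "\<And>r \<epsilon>. 0 < r \<Longrightarrow> r < 1 \<Longrightarrow> 0 < \<epsilon> \<Longrightarrow>
           finite {\<nu>. \<exists>g\<in>GL2_preimage U. gauss_norm r (w \<nu> g) \<ge> \<epsilon>}"
    and conv: "\<And>X r \<epsilon>. X \<in> M2 Zp \<Longrightarrow> 0 < r \<Longrightarrow> r < 1 \<Longrightarrow> 0 < \<epsilon> \<Longrightarrow>
           (\<forall>\<^sub>F F in finite_subsets_at_top UNIV. \<forall>g\<in>GL2_preimage U.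
              gauss_norm r (\<lambda>s. f (g ** (mat 1 + scale_mat (of_nat p ^ n) X)) s
                                - (\<Sum>\<nu>\<in>F. monomial X \<nu> * w \<nu> g s)) < \<epsilon>)"
    using an unfolding analytic_vector_def by blast
  have "g \<in> GL2_Zp" using g unfolding GL2_preimage_def by blast
  then obtain g' where g': "g' \<in> M2 Zp" "g ** g' = mat 1" "g \<in> M2 Zp"
    unfolding GL2_Zp_def by blast
  define Y where "Y = g' ** mat2 0 1 0 0 ** g"
  have Y: "Y \<in> M2 Zp" unfolding Y_def by (intro M2_mult g' mat2_in_M2) auto
  have xY: "scale_mat x Y \<in> M2 Zp" if "x \<in> Zp" for x
    using that Y unfolding M2_def by (auto intro: Zp_mult)
  define \<phi> where "\<phi> = (\<lambda>x. f (g ** (mat 1 + scale_mat (of_nat p ^ n) (scale_mat x Y))) s)"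
  have sums: "((\<lambda>\<nu>. (monomial Y \<nu> * w \<nu> g s) * x ^ total_degree \<nu>) has_sum \<phi> x) UNIV" if "x \<in> Zp" for x
  proof -
    have "((\<lambda>\<nu>. monomial (scale_mat x Y) \<nu> * w \<nu> g s) has_sum \<phi> x) UNIV"
      unfolding \<phi>_def
      by (rule analytic_vector_has_sum[OF f w g stable[OF g xY[OF that]]])
        (intro conv xY that, auto)
    then show ?thesis by (simp add: monomial_scale mult_ac)
  qed
  have null: "null_family (\<lambda>\<nu>. monomial Y \<nu> * w \<nu> g s)"
    by (rule null_family_mono[OF O_inf_null_family(1)[OF w g fin]])
      (auto simp: absval_mult intro!: mult_left_le_one_le absval_monomial_le_1 Y)
  define N where "N = (LEAST n. s * of_nat p ^ n \<in> \<int>)"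
  define j where "j = nat \<lfloor>s * of_nat p ^ N\<rfloor>"
  have s: "s \<in> exponents p" using O_inf_in_OD[OF f g] ne unfolding OD_def by blast
  then have sN: "s * of_nat p ^ N \<in> \<int>" "s \<ge> 0"
    unfolding N_def exponents_def by (auto intro: LeastI)
  then obtain z where z: "s * of_nat p ^ N = of_int z" by (auto elim: Ints_cases)
  have "z \<ge> 0" using sN(2) z p_pos(4) by (metis of_int_0_le_iff of_nat_0_le_iff mult_nonneg_nonneg zero_le_power)
  then have j: "s * of_nat p ^ N = of_nat j" unfolding j_def z by simp
  \<comment> \<open>The parameter is a multiple of \<open>e\<close> so that the exponent \<open>h / e\<close> of the root of unity is a natural
      number.\<close>
  have eqv: "f g s = \<zeta> N ^ (p ^ n * k * j) * \<phi> (of_nat (e * k))" for k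
  proof -
    define h where "h = (of_nat p ^ n * of_nat (e * k) :: 'c)"
    have "h \<in> Zp" unfolding h_def by (intro Zp_mult of_nat_in_Zp) (simp flip: of_nat_power)
    then have "f g = Zp_act p e \<zeta> h (f (mat2 1 h 0 1 ** g))"
      using f g unfolding O_inf_def by blast
    then have "f g s = root_power p \<zeta> N (h / of_nat e) ^ j * f (mat2 1 h 0 1 ** g) s"
      unfolding Zp_act_def Let_def N_def j_def by metis
    moreover have "f (mat2 1 h 0 1 ** g) s = \<phi> (of_nat (e * k))"
      unfolding \<phi>_def h_def Y_def unipotent_left_mult[OF g'(2)] ..
    moreover have "h / of_nat e = of_nat (p ^ n * k)"
      unfolding h_def using e by simp
    ultimately show ?thesis
      by (simp only: root_power_of_nat[OF prime normalised \<zeta>] power_mult[symmetric])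
  qed
  have \<phi>0: "\<phi> 0 = f g s" using eqv[of 0] by simp
  have "\<phi> (of_nat e) = \<phi> 0"
  proof (rule graded_series_constant[OF null finite_total_degree_le sums])
    have "(\<lambda>M. of_nat e * of_nat p ^ N * of_nat p ^ M :: 'c) \<longlonglongrightarrow> of_nat e * of_nat p ^ N * 0"
      by (intro tendsto_cmult_ultrametric tendsto_p_power_0 prime normalised)
    then show "(\<lambda>M. of_nat (e * p ^ (N + M)) :: 'c) \<longlonglongrightarrow> 0"
      by (simp add: power_add mult.assoc)
    show "of_nat (e * p ^ (N + M)) \<noteq> (0::'c)" for M using e p_pos by simp
    have "\<zeta> N ^ (p ^ n * p ^ (N + M) * j) = (\<zeta> N ^ p ^ N) ^ (p ^ n * p ^ M * j)" for M
      by (simp flip: power_mult add: power_add mult_ac)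
    also have "\<dots> M = 1" for M using \<zeta> unfolding compatible_roots_def by simp
    finally show "\<phi> (of_nat (e * p ^ (N + M))) = \<phi> 0" for M
      using eqv[of "p ^ (N + M)"] by (simp add: \<phi>0)
    show "of_nat (e * p ^ (N + M)) \<in> (Zp :: 'c set)" "of_nat e \<in> (Zp :: 'c set)" for M
      by (rule of_nat_in_Zp)+
  qed auto
  then have "\<zeta> N ^ (p ^ n * j) = 1" using eqv[of 1] ne \<phi>0 by simp
  then have dvd: "p ^ N dvd p ^ n * j" by (rule root_order_dvd[OF \<zeta> p_pos(2)])
  have "N \<le> n"
  proof (rule ccontr)
    assume "\<not> N \<le> n"
    then have N: "N = n + Suc (N - Suc n)" by simp
    have "p ^ n * p ^ Suc (N - Suc n) dvd p ^ n * j" using dvd N by (metis power_add)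
    then have "p ^ Suc (N - Suc n) dvd j" using p_pos(2) by simp
    then have "p dvd j" by (metis dvd_mult_left power_Suc)
    then obtain i where i: "j = p * i" by blast
    have "s * of_nat p ^ (N - 1) * of_nat p = of_nat i * of_nat p"
      using j N unfolding i by (metis Suc_diff_1 add_Suc_right mult.assoc mult.commute of_nat_mult power_Suc zero_less_Suc)
    then have "s * of_nat p ^ (N - 1) = of_nat i" using p_pos by simp
    then have "s * of_nat p ^ (N - 1) \<in> \<int>" by simp
    moreover have "N - 1 < N" using N by simp
    ultimately show False unfolding N_def using not_less_Least by blast
  qed
  then have "s * of_nat p ^ n = of_int z * of_nat p ^ (n - N)"
    unfolding z[symmetric] by (simp add: mult.assoc flip: power_add)
  then show ?thesis by simp
qed

text \<open>Restricting the orbit map to matrices with zero first column leaves the monomials in the other two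
  entries. Coefficients at exponents outside \<open>p\<^sup>-\<^sup>n \<int>\<close> are dropped: they contribute nothing to the values
  of \<open>f\<close> by \<open>analytic_vector_level\<close>.\<close>
lemma analytic_vector_expands:
  assumes an: "analytic_vector p e \<zeta> n U f" and \<zeta>: "compatible_roots p \<zeta>" and e: "0 < e"
    and g: "g \<in> GL2_preimage U"
  shows "\<exists>C. expands n C f g"
proof -
  obtain w where f: "f \<in> O_inf p e \<zeta> U"
    and stable: "\<And>g X. g \<in> GL2_preimage U \<Longrightarrow> X \<in> M2 Zp \<Longrightarrow>
      g ** (mat 1 + scale_mat (of_nat p ^ n) X) \<in> GL2_preimage U"
    and w: "\<And>\<nu>. w \<nu> \<in> O_inf p e \<zeta> U"
    and fin: "\<And>r \<epsilon>. 0 < r \<Longrightarrow> r < 1 \<Longrightarrow> 0 < \<epsilon> \<Longrightarrow>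
           finite {\<nu>. \<exists>g\<in>GL2_preimage U. gauss_norm r (w \<nu> g) \<ge> \<epsilon>}"
    and conv: "\<And>X r \<epsilon>. X \<in> M2 Zp \<Longrightarrow> 0 < r \<Longrightarrow> r < 1 \<Longrightarrow> 0 < \<epsilon> \<Longrightarrow>
           (\<forall>\<^sub>F F in finite_subsets_at_top UNIV. \<forall>g\<in>GL2_preimage U.
              gauss_norm r (\<lambda>s. f (g ** (mat 1 + scale_mat (of_nat p ^ n) X)) s
                                - (\<Sum>\<nu>\<in>F. monomial X \<nu> * w \<nu> g s)) < \<epsilon>)"
    using an unfolding analytic_vector_def by blast
  define \<iota> where "\<iota> = (\<lambda>(i::nat, l::nat). mat2 0 i 0 l)"
  have inj: "inj \<iota>" unfolding \<iota>_def inj_on_def by (auto simp: mat2_eq_iff)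
  define C where "C = (\<lambda>\<nu> s. if s * of_nat p ^ n \<in> \<int> then w (\<iota> \<nu>) g s else 0)"
  have le: "absval (C \<nu> s) \<le> absval (w (\<iota> \<nu>) g s)" for \<nu> s by (simp add: C_def)
  have "analytic_coeffs n C"
    unfolding analytic_coeffs_def
  proof (intro conjI allI impI)
    fix \<nu> s assume "C \<nu> s \<noteq> 0"
    then have "s * of_nat p ^ n \<in> \<int>" "w (\<iota> \<nu>) g s \<noteq> 0" by (auto simp: C_def split: if_splits)
    moreover from this O_inf_in_OD[OF w g, of "\<iota> \<nu>"] have "s \<ge> 0"
      unfolding OD_def exponents_def by blast
    ultimately show "0 \<le> s" "s * of_nat p ^ n \<in> \<int>" by auto
  next
    fix r :: real assume "0 < r \<and> r < 1"
    then obtain M where M: "\<And>\<nu> s. absval (w \<nu> g s) * r powr real_of_rat s \<le> M"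
      using O_inf_null_family(2)[OF w g fin] by blast
    have "absval (C \<nu> s) * r powr real_of_rat s \<le> M" for \<nu> s
      using mult_right_mono[OF le[of \<nu> s], of "r powr real_of_rat s"] M[of "\<iota> \<nu>" s] by simp
    then show "\<exists>M. \<forall>\<nu> s. absval (C \<nu> s) * r powr real_of_rat s \<le> M" by blast
  next
    fix s
    show "null_family (\<lambda>\<nu>. C \<nu> s)"
      by (rule null_family_mono[OF null_family_inj[OF O_inf_null_family(1)[OF w g fin] inj] le])
  qed
  moreover have "f (shear n g x y) s = series_at C x y s" if xy: "x \<in> Zp" "y \<in> Zp" for x y s
  proof -
    have X: "mat2 0 x 0 y \<in> M2 Zp" using xy by (intro mat2_in_M2) auto
    have mem: "shear n g x y \<in> GL2_preimage U" unfolding shear_def by (intro stable g X)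
    show ?thesis
    proof (cases "s * of_nat p ^ n \<in> \<int>")
      case False
      then have "f (shear n g x y) s = 0" using analytic_vector_level[OF an \<zeta> e mem] by blast
      with False show ?thesis by (simp add: series_at_def series_def C_def case_prod_unfold)
    next
      case True
      let ?t = "\<lambda>\<nu>. monomial (mat2 0 x 0 y) \<nu> * w \<nu> g s"
      have "(?t has_sum f (shear n g x y) s) UNIV"
        unfolding shear_def
        by (rule analytic_vector_has_sum[OF f w g stable[OF g X]]) (intro conv X, auto)
      moreover have "?t \<nu> = 0" if "\<nu> \<notin> range \<iota>" for \<nu>
      proof -
        have "\<nu> \<noteq> \<iota> (\<nu>$1$2, \<nu>$2$2)" using that by blast
        then have "\<nu>$1$1 \<noteq> 0 \<or> \<nu>$2$1 \<noteq> 0" unfolding \<iota>_def by (auto simp: mat2_eq_iff)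
        then show ?thesis by (auto simp: monomial_2)
      qed
      ultimately have "(?t has_sum f (shear n g x y) s) (range \<iota>)"
        using has_sum_cong_neutral[of UNIV "range \<iota>" ?t ?t] by blast
      then have "((?t \<circ> \<iota>) has_sum f (shear n g x y) s) UNIV"
        using has_sum_reindex[OF inj, of ?t] by blast
      moreover have "(?t \<circ> \<iota>) = (\<lambda>(i,l). C (i,l) s * (x ^ i * y ^ l))"
        using True by (auto simp: fun_eq_iff C_def \<iota>_def monomial_2)
      ultimately show ?thesis
        unfolding series_at_def series_def by (simp add: infsumI)
    qed
  qed
  ultimately show ?thesis unfolding expands_def by blast
qed

end

section \<open>The intertwining operator\<close>

lemma q_ddq_scaled_iterate:
  "((\<lambda>f g s. q_ddq f g s / of_nat e) ^^ k) h g s = (q_ddq ^^ k) h g s / of_nat e ^ k"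
  for h :: "'c::ultrametric_field sect"
  by (induction k arbitrary: g s) (auto simp: q_ddq_def)

theorem proposition1p1:
  fixes p e k :: nat and N :: int
    and \<zeta> :: "nat \<Rightarrow> 'c::ultrametric_field"
    and U :: "('c^2) set set"
    and f :: "'c^2^2 \<Rightarrow> rat \<Rightarrow> 'c"
  assumes "prime p"
    and "is_completed_algebraic_closure p TYPE('c)"
    and "coprime N (int p)"
    and "0 < e" and "int e dvd N"
    and "compatible_roots p \<zeta>"
    and "1 \<le> k"
    and "open_P1 U"
    and "line (vector [0, 1]) \<notin> U"
    and "f \<in> O_la_weight p e \<zeta> (1 - int k) 0 U"
  shows "\<forall>g\<in>GL2_preimage U.
    intertwining p e k f g =
      (\<lambda>s. det g ^ k / (of_nat e ^ k * (g$2$1) ^ (2 * k)) *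
           (a_b_plus_c_d p ^^ k) ((q_ddq ^^ k) f) g s)"
proof
  fix g assume g: "g \<in> GL2_preimage U"
  interpret completed_field p "TYPE('c)"
    using assms(1,2) by unfold_locales (auto simp: is_completed_algebraic_closure_def)
  have "f \<in> O_la p e \<zeta> U" using assms(10) unfolding O_la_weight_def by blast
  moreover have gU: "line (row 2 g) \<in> U" "g \<in> GL2_Zp" using g unfolding GL2_preimage_def by auto
  ultimately obtain U' n where "line (row 2 g) \<in> U'" and an: "analytic_vector p e \<zeta> n U' f"
    unfolding O_la_def by blast
  then have "g \<in> GL2_preimage U'" using gU unfolding GL2_preimage_def by simp
  then obtain C where C: "expands n C f g"
    using analytic_vector_expands[OF an assms(6,4)] by blast
  show "intertwining p e k f g =
      (\<lambda>s. det g ^ k / (of_nat e ^ k * (g$2$1) ^ (2 * k)) *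
           (a_b_plus_c_d p ^^ k) ((q_ddq ^^ k) f) g s)"
    by (simp add: intertwining_def q_ddq_scaled_iterate q_ddq_gl2_act_eq_a_b_plus_c_d_q_ddq[OF C gU(2)] mult_ac)
qed

end
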